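(* Let $\Gamma_1,\dots,\Gamma_k$ be graphs with $d$ vertices (loops and multiple edges allowed) and let $W_1\le S_d,\dots,W_k\le S_d$ be their automorphism groups, respectively. If the group $W_1$ is cyclic of order $b$ and if $a$ is a divisor of $b$, then the number of all superpositions of $\Gamma_1,\dots,\Gamma_k$ which have a cyclic automorphism group of order dividing $a$ is $$ N\bigl(Z(\varrho^{(a)};p_1,\dots,p_d)\ast Z(1_{W_2};p_1,\dots,p_d)\ast\cdots\ast Z(1_{W_k};p_1,\dots,p_d)\bigr), $$ where $\varrho^{(a)}\colon W_1\to K$ is a one-dimensional character whose kernel has order $a$.
   Context: $K$ is an algebraically closed field of characteristic zero; $d,k\ge1$; $S_d$ is the symmetric group; a one-dimensional character of a group $W$ is a homomorphism $W\to K^*$; $1_W$ is the trivial character. The graphs have vertex set $\{1,\dots,d\}$, and the automorphism group of a graph is the group of vertex permutations preserving edge multiplicities. Superpositions of $\Gamma_1,\dots,\Gamma_k$ are the ways of placing the graphs on a common set of $d$ vertices, up to simultaneous relabelling of the vertices; that is, the equivalence classes of tuples $(a_1,\dots,a_k)\in S_d\times\cdots\times S_d$ (where $a_m$ represents the placed copy $a_m\Gamma_m$) under $(a_1,\dots,a_k)\sim(b_1,\dots,b_k)$ iff there are $\zeta\in S_d$ and $w_m\in W_m$ with $b_m=\zeta a_mw_m$ for all $m$. The automorphism group of the superposition represented by $(a_1,\dots,a_k)$ is $a_1W_1a_1^{-1}\cap\cdots\cap a_kW_ka_k^{-1}$ (well defined up to conjugation in $S_d$). For $W\le S_d$ and a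 one-dimensional character $\chi$ of $W$, $Z(\chi;p_1,\dots,p_d)=|W|^{-1}\sum_{\sigma\in W}\chi(\sigma)p_1^{c_1(\sigma)}\cdots p_d^{c_d(\sigma)}$, where $c_s(\sigma)$ is the number of cycles of length $s$ of $\sigma$ and $p_s=\sum_{i\ge0}x_i^s$ are the power sums in $x_0,x_1,\dots$. With $R^d$ the group of generalized characters of $S_d$, $\Lambda^d$ the group of homogeneous degree $d$ symmetric functions with integer coefficients in $x_0,x_1,\dots$, and $ch\colon R^d\to\Lambda^d$ the (bijective) characteristic map $ch(u)=\frac1{d!}\sum_{\sigma\in S_d}u(\sigma)p_1^{c_1(\sigma)}\cdots p_d^{c_d(\sigma)}$, one has $Z(\chi;p_1,\dots,p_d)=ch(\mathrm{ind}_W^{S_d}(\chi))$, and the internal product on $\Lambda^d$ is defined by $ch(u)\ast ch(v)=ch(uv)$. For a polynomial $A$ in $p_1,\dots,p_d$, $N(A)$ is the sum of its coefficients. *)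

theory Defs
  imports
    "HOL-Library.Poly_Mapping"
    "HOL-Library.Uprod"
    "HOL-Library.Multiset"
    "HOL-Combinatorics.Orbits"
    "HOL-Algebra.Sym_Groups"
    "HOL-Algebra.Elementary_Groups"
    "HOL-Algebra.Multiplicative_Group"
    "HOL-Algebra.Algebraic_Closure_Type"
    "Jordan_Normal_Form.Matrix"
begin

text \<open>Formal power series in $x_0, x_1, \ldots$: a monomial is a finitely supported exponent function,
  and a series is an arbitrary function assigning a coefficient to every monomial, since power sums
  involve infinitely many monomials.\<close>

typedef 'a mfps = "UNIV :: ((nat \<Rightarrow>\<^sub>0 nat) \<Rightarrow> 'a) set"
  morphisms mcoeff Abs_mfps
  by simp

setup_lifting type_definition_mfps

lemma mfps_eqI: "(\<And>m. mcoeff F m = mcoeff G m) \<Longrightarrow> F = G"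
  by transfer auto

lemma finite_monomial_splits: "finite {(a, b). a + b = (m :: nat \<Rightarrow>\<^sub>0 nat)}"
proof -
  let ?D = "{(a, b). a + b = m}"
  let ?f = "\<lambda>p. restrict (Poly_Mapping.lookup (fst p)) (Poly_Mapping.keys m)"
  have le: "Poly_Mapping.lookup (fst p) i \<le> Poly_Mapping.lookup m i" if "p \<in> ?D" for p i
    using that by (auto simp: lookup_add)
  have "?f ` ?D \<subseteq> PiE (Poly_Mapping.keys m) (\<lambda>i. {..Poly_Mapping.lookup m i})"
    using le by auto
  then have "finite (?f ` ?D)"
    by (rule finite_subset) (auto intro: finite_PiE)
  moreover have "inj_on ?f ?D"
  proof (rule inj_onI)
    fix p q assume p: "p \<in> ?D" and q: "q \<in> ?D" and eq: "?f p = ?f q"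
    have "Poly_Mapping.lookup (fst p) i = Poly_Mapping.lookup (fst q) i" for i
    proof (cases "i \<in> Poly_Mapping.keys m")
      case True
      then show ?thesis using fun_cong[OF eq, of i] by simp
    next
      case False
      then have "Poly_Mapping.lookup m i = 0" by (simp add: in_keys_iff)
      then show ?thesis using le[OF p, of i] le[OF q, of i] by simp
    qed
    then have "fst p = fst q" by (rule poly_mapping_eqI)
    moreover have "fst p + snd p = fst q + snd q" using p q by auto
    ultimately show "p = q" by (simp add: prod_eq_iff)
  qed
  ultimately show ?thesis by (rule finite_imageD)
qed

instantiation mfps :: (comm_ring_1) comm_ring_1
begin

lift_definition zero_mfps :: "'a mfps" is "\<lambda>_. 0" .
lift_definition one_mfps :: "'a mfps" is "\<lambda>m. if m = 0 then 1 else 0" .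
lift_definition plus_mfps :: "'a mfps \<Rightarrow> 'a mfps \<Rightarrow> 'a mfps" is "\<lambda>F G m. F m + G m" .
lift_definition minus_mfps :: "'a mfps \<Rightarrow> 'a mfps \<Rightarrow> 'a mfps" is "\<lambda>F G m. F m - G m" .
lift_definition uminus_mfps :: "'a mfps \<Rightarrow> 'a mfps" is "\<lambda>F m. - F m" .
lift_definition times_mfps :: "'a mfps \<Rightarrow> 'a mfps \<Rightarrow> 'a mfps"
  is "\<lambda>F G m. \<Sum>(a, b) \<in> {(a, b). a + b = m}. F a * G b" .

instance
proof
  fix F G H :: "'a mfps"
  show "F * G * H = F * (G * H)"
  proof (rule mfps_eqI)
    fix m
    let ?D = "\<lambda>m :: nat \<Rightarrow>\<^sub>0 nat. {(a, b). a + b = m}"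
    have "mcoeff (F * G * H) m =
        (\<Sum>p\<in>?D m. \<Sum>q\<in>?D (fst p). mcoeff F (fst q) * mcoeff G (snd q) * mcoeff H (snd p))"
      by (simp add: times_mfps.rep_eq case_prod_unfold sum_distrib_right)
    also have "\<dots> = (\<Sum>(p, q) \<in> Sigma (?D m) (\<lambda>p. ?D (fst p)).
        mcoeff F (fst q) * mcoeff G (snd q) * mcoeff H (snd p))"
      by (rule sum.Sigma) (auto simp: finite_monomial_splits)
    also have "\<dots> = (\<Sum>(p, q) \<in> Sigma (?D m) (\<lambda>p. ?D (snd p)).
        mcoeff F (fst p) * (mcoeff G (fst q) * mcoeff H (snd q)))"
      by (rule sum.reindex_bij_witness
            [where i = "\<lambda>(p, q). ((fst p + fst q, snd q), (fst p, fst q))"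
               and j = "\<lambda>(p, q). ((fst q, snd q + snd p), (snd q, snd p))"])
         (auto simp: ac_simps)
    also have "\<dots> = (\<Sum>p\<in>?D m. \<Sum>q\<in>?D (snd p).
        mcoeff F (fst p) * (mcoeff G (fst q) * mcoeff H (snd q)))"
      by (rule sum.Sigma[symmetric]) (auto simp: finite_monomial_splits)
    also have "\<dots> = mcoeff (F * (G * H)) m"
      by (simp add: times_mfps.rep_eq case_prod_unfold sum_distrib_left)
    finally show "mcoeff (F * G * H) m = mcoeff (F * (G * H)) m" .
  qed
  show "F * G = G * F"
  proof (rule mfps_eqI)
    fix m
    show "mcoeff (F * G) m = mcoeff (G * F) m"
      unfolding times_mfps.rep_eq
      by (rule sum.reindex_bij_witness[where i = prod.swap and j = prod.swap])
         (auto simp: ac_simps)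
  qed
  show "1 * F = F"
  proof (rule mfps_eqI)
    fix m
    have "mcoeff (1 * F) m =
        (\<Sum>p\<in>{(a, b). a + b = m}. if p = (0, m) then mcoeff F m else 0)"
      unfolding times_mfps.rep_eq one_mfps.rep_eq by (rule sum.cong) (auto split: if_splits)
    also have "\<dots> = mcoeff F m"
      using finite_monomial_splits[of m] by (simp add: sum.delta)
    finally show "mcoeff (1 * F) m = mcoeff F m" .
  qed
  show "(F + G) * H = F * H + G * H"
    by (rule mfps_eqI)
       (simp add: times_mfps.rep_eq plus_mfps.rep_eq case_prod_unfold distrib_right sum.distrib)
  show "F + G + H = F + (G + H)" by transfer (simp add: ac_simps)
  show "F + G = G + F" by transfer (simp add: ac_simps)
  show "0 + F = F" by transfer simp
  show "- F + F = 0" by transfer simp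
  show "F - G = F + - G" by transfer simp
  show "(0 :: 'a mfps) \<noteq> 1"
    by transfer (metis zero_neq_one)
qed

end

lift_definition mscale :: "'a \<Rightarrow> 'a mfps \<Rightarrow> 'a :: comm_ring_1 mfps" is "\<lambda>c F m. c * F m" .

text \<open>For $s \ge 1$ this is $p_s = \sum_{i \ge 0} x_i^s$.\<close>

lift_definition psum :: "nat \<Rightarrow> 'a :: comm_ring_1 mfps"
  is "\<lambda>s m. if \<exists>i. m = Poly_Mapping.single i s then 1 else 0" .

text \<open>A polynomial $A$ in $d$ indeterminates is represented by its coefficients, indexed by exponent
  functions supported in $\{1, \ldots, d\}$; \<open>eval_psum\<close> substitutes $p_s$ for the $s$-th
  indeterminate.\<close>

definition eval_psum :: "nat \<Rightarrow> ((nat \<Rightarrow>\<^sub>0 nat) \<Rightarrow>\<^sub>0 'k) \<Rightarrow> 'k :: comm_ring_1 mfps" where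
  "eval_psum d A = (\<Sum>m\<in>Poly_Mapping.keys A.
      mscale (Poly_Mapping.lookup A m) (\<Prod>s = 1..d. psum s ^ Poly_Mapping.lookup m s))"

text \<open>$N(F)$ for a series $F$ that is a polynomial in $p_1, \ldots, p_d$. The value does not depend
  on the polynomial, since $p_1, \ldots, p_d$ are algebraically independent.\<close>

definition coeff_sum :: "nat \<Rightarrow> 'k :: comm_ring_1 mfps \<Rightarrow> 'k" where
  "coeff_sum d F = (THE n. \<exists>A. (\<forall>m\<in>Poly_Mapping.keys A. Poly_Mapping.keys m \<subseteq> {1..d}) \<and>
      F = eval_psum d A \<and> n = (\<Sum>m\<in>Poly_Mapping.keys A. Poly_Mapping.lookup A m))"

definition num_cycles :: "nat \<Rightarrow> nat \<Rightarrow> (nat \<Rightarrow> nat) \<Rightarrow> nat" where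
  "num_cycles d s \<sigma> = card {C \<in> orbit \<sigma> ` {1..d}. card C = s}"

definition cycle_psum :: "nat \<Rightarrow> (nat \<Rightarrow> nat) \<Rightarrow> 'k :: comm_ring_1 mfps" where
  "cycle_psum d \<sigma> = (\<Prod>s = 1..d. psum s ^ num_cycles d s \<sigma>)"

definition mat_trace :: "'k :: comm_ring_1 mat \<Rightarrow> 'k" where
  "mat_trace A = (\<Sum>i < dim_row A. A $$ (i, i))"

abbreviation GL :: "nat \<Rightarrow> 'k :: field mat monoid" where
  "GL n \<equiv> units_of (ring_mat TYPE('k) n ())"

text \<open>Class functions are taken to be \<open>undefined\<close> outside the symmetric group, so that they are
  determined by their values on it.\<close>

definition sym_characters :: "nat \<Rightarrow> ((nat \<Rightarrow> nat) \<Rightarrow> 'k :: field) set" where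
  "sym_characters d = {(\<lambda>\<sigma>\<in>carrier (sym_group d). mat_trace (r \<sigma>)) | n r.
      r \<in> hom (sym_group d) (GL n)}"

definition gen_characters :: "nat \<Rightarrow> ((nat \<Rightarrow> nat) \<Rightarrow> 'k :: field) set" where
  "gen_characters d = {(\<lambda>\<sigma>\<in>carrier (sym_group d). \<phi> \<sigma> - \<psi> \<sigma>) | \<phi> \<psi>.
      \<phi> \<in> sym_characters d \<and> \<psi> \<in> sym_characters d}"

definition ch :: "nat \<Rightarrow> ((nat \<Rightarrow> nat) \<Rightarrow> 'k) \<Rightarrow> 'k :: field_char_0 mfps" where
  "ch d u = mscale (1 / fact d) (\<Sum>\<sigma>\<in>carrier (sym_group d). mscale (u \<sigma>) (cycle_psum d \<sigma>))"

text \<open>The internal product, determined by \<open>ch d u * ch d v = ch d (u v)\<close> for generalized characters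
  \<open>u\<close>, \<open>v\<close>; it is unspecified on arguments outside the image of the generalized characters.\<close>

definition internal_prod :: "nat \<Rightarrow> 'k mfps \<Rightarrow> 'k mfps \<Rightarrow> 'k :: field_char_0 mfps" where
  "internal_prod d A B = (let u = inv_into (gen_characters d) (ch d) A;
                              v = inv_into (gen_characters d) (ch d) B
                          in ch d (\<lambda>\<sigma>\<in>carrier (sym_group d). u \<sigma> * v \<sigma>))"

definition cycle_index :: "nat \<Rightarrow> (nat \<Rightarrow> nat) set \<Rightarrow> ((nat \<Rightarrow> nat) \<Rightarrow> 'k) \<Rightarrow> 'k :: field mfps" where
  "cycle_index d W \<chi> = mscale (1 / of_nat (card W)) (\<Sum>\<sigma>\<in>W. mscale (\<chi> \<sigma>) (cycle_psum d \<sigma>))"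

abbreviation sub_sym :: "nat \<Rightarrow> (nat \<Rightarrow> nat) set \<Rightarrow> (nat \<Rightarrow> nat) monoid" where
  "sub_sym d W \<equiv> sym_group d \<lparr>carrier := W\<rparr>"

abbreviation mult_field :: "'k :: field monoid" where
  "mult_field \<equiv> mult_of (ring_of_type_algebra :: 'k ring)"

text \<open>A graph on \<open>{1..d}\<close> is the multiset of its edges; an edge is an unordered pair whose two
  entries may coincide (a loop).\<close>

definition multigraph :: "nat \<Rightarrow> nat uprod multiset \<Rightarrow> bool" where
  "multigraph d E \<longleftrightarrow> (\<forall>e\<in>#E. set_uprod e \<subseteq> {1..d})"

definition graph_aut :: "nat \<Rightarrow> nat uprod multiset \<Rightarrow> (nat \<Rightarrow> nat) set" where
  "graph_aut d E = {\<sigma> \<in> carrier (sym_group d).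
      \<forall>i\<in>{1..d}. \<forall>j\<in>{1..d}. count E (Upair (\<sigma> i) (\<sigma> j)) = count E (Upair i j)}"

text \<open>Tuples $(a_1, \ldots, a_k)$ are functions on \<open>{1..k}\<close>, \<open>undefined\<close> elsewhere.\<close>

definition perm_tuples :: "nat \<Rightarrow> nat \<Rightarrow> (nat \<Rightarrow> nat \<Rightarrow> nat) set" where
  "perm_tuples d k = {1..k} \<rightarrow>\<^sub>E carrier (sym_group d)"

definition superpos_rel ::
    "nat \<Rightarrow> nat \<Rightarrow> (nat \<Rightarrow> (nat \<Rightarrow> nat) set) \<Rightarrow> ((nat \<Rightarrow> nat \<Rightarrow> nat) \<times> (nat \<Rightarrow> nat \<Rightarrow> nat)) set" where
  "superpos_rel d k W = {(x, y). x \<in> perm_tuples d k \<and> y \<in> perm_tuples d k \<and>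
      (\<exists>\<zeta>\<in>carrier (sym_group d). \<exists>w. \<forall>m\<in>{1..k}. w m \<in> W m \<and> y m = \<zeta> \<circ> x m \<circ> w m)}"

definition superpositions ::
    "nat \<Rightarrow> nat \<Rightarrow> (nat \<Rightarrow> (nat \<Rightarrow> nat) set) \<Rightarrow> (nat \<Rightarrow> nat \<Rightarrow> nat) set set" where
  "superpositions d k W = perm_tuples d k // superpos_rel d k W"

definition superpos_aut ::
    "nat \<Rightarrow> nat \<Rightarrow> (nat \<Rightarrow> (nat \<Rightarrow> nat) set) \<Rightarrow> (nat \<Rightarrow> nat \<Rightarrow> nat) \<Rightarrow> (nat \<Rightarrow> nat) set" where
  "superpos_aut d k W x = (\<Inter>m\<in>{1..k}. {x m \<circ> w \<circ> inv\<^bsub>sym_group d\<^esub> (x m) | w. w \<in> W m})"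

end

(* All the characters involved are induced from linear characters of subgroups of S_d, and
   the power sums are algebraically independent, so ch is injective on generalized characters and N
   applied to ch(u) is the average of u over S_d, that is, the multiplicity of the trivial character.
   Expanding the induced characters turns this average, for u the product of the induced characters,
   into a sum over tuples x of the sums of a linear character, transported from W_1, over the
   automorphism group of x. Such a sum is the order of the automorphism group if the transported
   character is trivial and 0 otherwise; in the cyclic group W_1 triviality means that the order of
   the automorphism group divides a. By orbit counting, each class of tuples then contributes 1. *)

theory Submission
  imports Defs
begin

text \<open>The definitions hide two obligations. \<open>coeff_sum\<close> is a definite description
  and \<open>internal_prod\<close> inverts \<open>ch\<close> by \<open>inv_into\<close>, so neither
  can be evaluated before it is known that a polynomial in p_1, ..., p_d is determined by its value
  as a series and that every factor really lies in \<open>gen_characters\<close>. The former is a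
  leading-term argument ordered by the number of parts of a partition; combined with the conjugacy
  of permutations of equal cycle type it recovers a generalized character from its image. The latter
  forces explicit matrices: an induced character is the trace of a monomial representation on a left
  transversal, and products are traces of Kronecker products. The denominators make the count come
  out: the average over S_d and the factors 1/|W_m| multiply to the inverse of |S_d| |W_1| ...
  |W_k|, which is the size of a class of tuples times the order of the automorphism group of any of
  its members. Orders can detect triviality of a character because a cyclic group has at most one
  subgroup of each order, so that inclusion of subgroups is divisibility of their orders.\<close>

section \<open>Linear independence of products of power sums\<close>

lemma single_add_diff:
  fixes \<mu> :: "nat \<Rightarrow>\<^sub>0 nat"
  assumes "s \<le> Poly_Mapping.lookup \<mu> i"
  shows "Poly_Mapping.single i s + (\<mu> - Poly_Mapping.single i s) = \<mu>"
  using assms by (intro poly_mapping_eqI) (auto simp: lookup_add lookup_minus lookup_single when_def)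

text \<open>Only splittings of \<mu> whose left factor is some x_i^s contribute, and each
  contributes once: since s is positive, different i give different monomials.\<close>

lemma mcoeff_psum_times:
  assumes "s \<ge> 1"
  shows "mcoeff (psum s * F) \<mu> =
    (\<Sum>i | i \<in> Poly_Mapping.keys \<mu> \<and> s \<le> Poly_Mapping.lookup \<mu> i. mcoeff F (\<mu> - Poly_Mapping.single i s))"
proof -
  let ?D = "{(a, b). a + b = \<mu>}"
  let ?I = "{i. i \<in> Poly_Mapping.keys \<mu> \<and> s \<le> Poly_Mapping.lookup \<mu> i}"
  let ?h = "\<lambda>i. (Poly_Mapping.single i s, \<mu> - Poly_Mapping.single i s)"
  let ?f = "\<lambda>p. mcoeff (psum s) (fst p) * mcoeff F (snd p)"
  have inj: "inj_on ?h ?I"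
    using assms by (intro inj_onI) (auto dest!: arg_cong[where f = Poly_Mapping.keys])
  have "p \<in> ?h ` ?I" if "p \<in> ?D" "?f p \<noteq> 0" for p
  proof -
    from that(2) obtain i where i: "fst p = Poly_Mapping.single i s"
      by (auto simp: psum.rep_eq split: if_splits)
    with that(1) have \<mu>: "\<mu> = Poly_Mapping.single i s + snd p" by auto
    then have "s \<le> Poly_Mapping.lookup \<mu> i" by (simp add: lookup_add)
    moreover from this assms have "i \<in> Poly_Mapping.keys \<mu>" by (simp add: in_keys_iff)
    moreover have "p = ?h i" using i \<mu> by (simp add: prod_eq_iff)
    ultimately show ?thesis by blast
  qed
  moreover have "?h ` ?I \<subseteq> ?D" by (auto simp: single_add_diff)
  ultimately have "sum ?f ?D = sum ?f (?h ` ?I)"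
    by (intro sum.mono_neutral_right) (auto simp: finite_monomial_splits simp del: mult_eq_0_iff)
  also have "\<dots> = (\<Sum>i\<in>?I. mcoeff F (\<mu> - Poly_Mapping.single i s))"
    by (subst sum.reindex[OF inj]) (auto simp: psum.rep_eq intro!: sum.cong)
  finally show ?thesis by (simp add: times_mfps.rep_eq case_prod_unfold)
qed

text \<open>\<open>placements ls \<mu>\<close> counts the ways of assigning a variable to each part in \<open>ls\<close> such that the
  resulting monomial is \<open>\<mu>\<close>.\<close>

fun placements :: "nat list \<Rightarrow> (nat \<Rightarrow>\<^sub>0 nat) \<Rightarrow> nat" where
  "placements [] \<mu> = (if \<mu> = 0 then 1 else 0)"
| "placements (s # ls) \<mu> =
    (\<Sum>i | i \<in> Poly_Mapping.keys \<mu> \<and> s \<le> Poly_Mapping.lookup \<mu> i. placements ls (\<mu> - Poly_Mapping.single i s))"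

lemma mcoeff_prod_list_psum:
  assumes "\<forall>s\<in>set ls. s \<ge> 1"
  shows "mcoeff (prod_list (map psum ls)) \<mu> = of_nat (placements ls \<mu>)"
  using assms by (induction ls arbitrary: \<mu>) (auto simp: one_mfps.rep_eq mcoeff_psum_times)

text \<open>In characteristic zero a coefficient counting placements vanishes only if there is no
  placement, so independence needs existence alone. The list \<open>is\<close> names the variable
  that receives each part.\<close>

lemma placements_pos_iff:
  assumes "\<forall>s\<in>set ls. s \<ge> 1"
  shows "placements ls \<mu> > 0 \<longleftrightarrow>
    (\<exists>is. length is = length ls \<and> \<mu> = sum_list (map2 Poly_Mapping.single is ls))"
  using assms
proof (induction ls arbitrary: \<mu>)
  case (Cons s ls)
  let ?I = "{i. i \<in> Poly_Mapping.keys \<mu> \<and> s \<le> Poly_Mapping.lookup \<mu> i}"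
  have I: "i \<in> ?I" if "\<mu> = Poly_Mapping.single i s + \<nu>" for i \<nu>
    using that Cons.prems by (auto simp: in_keys_iff lookup_add)
  have "placements (s # ls) \<mu> > 0 \<longleftrightarrow> (\<exists>i\<in>?I. placements ls (\<mu> - Poly_Mapping.single i s) > 0)"
    by (simp flip: neq0_conv)
  also have "\<dots> \<longleftrightarrow> (\<exists>i\<in>?I. \<exists>is. length is = length ls \<and>
      \<mu> - Poly_Mapping.single i s = sum_list (map2 Poly_Mapping.single is ls))"
    using Cons.IH Cons.prems by simp
  also have "\<dots> \<longleftrightarrow> (\<exists>i is. length is = length ls \<and>
      \<mu> = Poly_Mapping.single i s + sum_list (map2 Poly_Mapping.single is ls))"
    using I by (metis (no_types, lifting) add_diff_cancel_left' mem_Collect_eq single_add_diff)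
  also have "\<dots> \<longleftrightarrow> (\<exists>is. length is = length (s # ls) \<and>
      \<mu> = sum_list (map2 Poly_Mapping.single is (s # ls)))"
  proof safe
    fix i and "is" :: "nat list"
    assume "length is = length ls"
    then show "\<exists>js. length js = length (s # ls) \<and>
        Poly_Mapping.single i s + sum_list (map2 Poly_Mapping.single is ls) =
        sum_list (map2 Poly_Mapping.single js (s # ls))"
      by (intro exI[of _ "i # is"]) simp
  next
    fix js :: "nat list"
    assume "length js = length (s # ls)"
    then show "\<exists>i is. length is = length ls \<and> sum_list (map2 Poly_Mapping.single js (s # ls)) =
        Poly_Mapping.single i s + sum_list (map2 Poly_Mapping.single is ls)"
      by (cases js) auto
  qed
  finally show ?case .
qed auto

lemma keys_sum_list_single:
  assumes "length is = length ls"
  shows "Poly_Mapping.keys (sum_list (map2 Poly_Mapping.single is ls) :: nat \<Rightarrow>\<^sub>0 nat) \<subseteq> set is"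
  using assms
proof (induction "is" ls rule: list_induct2)
  case (Cons i "is" s ls)
  then show ?case
    using keys_add[of "Poly_Mapping.single i s" "sum_list (map2 Poly_Mapping.single is ls)"]
    by (auto split: if_splits)
qed auto

text \<open>With distinct variables no two parts are merged into one exponent, so the nonzero
  exponents recover the parts. The key set is carried along because the induction step needs the new
  variable to be absent from the rest.\<close>

lemma mset_lookup_sum_list_single:
  assumes "length is = length ls" "distinct is" "\<forall>s\<in>set ls. s \<ge> (1::nat)"
  shows "image_mset (Poly_Mapping.lookup (sum_list (map2 Poly_Mapping.single is ls)))
    (mset_set (Poly_Mapping.keys (sum_list (map2 Poly_Mapping.single is ls)))) = mset ls
    \<and> Poly_Mapping.keys (sum_list (map2 Poly_Mapping.single is ls)) = set is"
  using assms
proof (induction "is" ls rule: list_induct2)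
  case (Cons i "is" s ls)
  let ?\<mu> = "sum_list (map2 Poly_Mapping.single is ls)"
  let ?\<nu> = "Poly_Mapping.single i s + ?\<mu>"
  have keys: "Poly_Mapping.keys ?\<mu> = set is" using Cons by auto
  have "i \<notin> Poly_Mapping.keys ?\<mu>" using Cons keys by auto
  then have 0: "Poly_Mapping.lookup ?\<mu> i = 0" by (simp add: in_keys_iff)
  have keys': "Poly_Mapping.keys ?\<nu> = insert i (set is)"
    using Cons.prems
    by (auto simp: in_keys_iff lookup_add lookup_single when_def keys[symmetric] split: if_splits)
  have "image_mset (Poly_Mapping.lookup ?\<nu>) (mset_set (set is)) = image_mset (Poly_Mapping.lookup ?\<mu>) (mset_set (set is))"
    using Cons.prems by (intro image_mset_cong) (auto simp: lookup_add lookup_single when_def)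
  then show ?case
    using Cons keys keys' 0 by (simp add: lookup_add[of _ _ i])
qed auto

text \<open>Distinct variables carry distinct parts, so a product of no more power sums than \<open>ls\<close> has
  parts contains the monomial with exponents \<open>ls\<close> only if its parts agree with \<open>ls\<close>.\<close>

lemma placements_longest:
  assumes "\<forall>s\<in>set ls. s \<ge> 1" "\<forall>s\<in>set ls'. s \<ge> 1" "length ls' \<le> length ls"
    and "placements ls' (sum_list (map2 Poly_Mapping.single [0..<length ls] ls)) > 0"
  shows "mset ls' = mset ls"
proof -
  let ?\<mu> = "sum_list (map2 Poly_Mapping.single [0..<length ls] ls)"
  obtain "is" where "is": "length is = length ls'" "?\<mu> = sum_list (map2 Poly_Mapping.single is ls')"
    using assms(2,4) placements_pos_iff by blast
  have \<mu>: "image_mset (Poly_Mapping.lookup ?\<mu>) (mset_set (Poly_Mapping.keys ?\<mu>)) = mset ls"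
    "Poly_Mapping.keys ?\<mu> = set [0..<length ls]"
    using mset_lookup_sum_list_single[of "[0..<length ls]" ls] assms(1) by auto
  have "set [0..<length ls] \<subseteq> set is"
    using keys_sum_list_single[OF "is"(1)] \<mu>(2) "is"(2) by simp
  \<comment> \<open>Pigeonhole: \<open>is\<close> has at most \<open>length ls\<close> entries but
    must cover that many variables, so it has no repetition.\<close>
  then have "card (set [0..<length ls]) \<le> card (set is)" by (intro card_mono) auto
  then have "length is \<le> card (set is)" using "is"(1) assms(3) by simp
  then have "distinct is" using card_length[of "is"] by (intro card_distinct) simp
  then show ?thesis
    using mset_lookup_sum_list_single[OF "is"(1)] assms(2) \<mu>(1) "is"(2) by metis
qed

text \<open>The partition written exponentially as 1^{m_1} 2^{m_2} ... d^{m_d}. Exponents outside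
  \<open>{1..d}\<close> are dropped, hence the support conditions in
  \<open>parts_list_inject\<close>.\<close>

definition parts_list :: "nat \<Rightarrow> (nat \<Rightarrow>\<^sub>0 nat) \<Rightarrow> nat list" where
  "parts_list d m = concat (map (\<lambda>s. replicate (Poly_Mapping.lookup m s) s) [1..<Suc d])"

lemma parts_list_ge_1: "\<forall>s\<in>set (parts_list d m). s \<ge> 1"
  by (auto simp: parts_list_def)

lemma prod_list_concat_replicate:
  "prod_list (map f (concat (map (\<lambda>s. replicate (e s) s) ls))) = prod_list (map (\<lambda>s. f s ^ e s) ls)"
  for f :: "'a \<Rightarrow> 'b :: comm_monoid_mult"
  by (induction ls) (simp_all add: prod_list_replicate)

lemma prod_list_parts_list:
  "prod_list (map psum (parts_list d m)) = (\<Prod>s = 1..d. psum s ^ Poly_Mapping.lookup m s)"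
proof -
  have "prod_list (map psum (parts_list d m)) = prod_list (map (\<lambda>s. psum s ^ Poly_Mapping.lookup m s) [1..<Suc d])"
    unfolding parts_list_def
    by (rule prod_list_concat_replicate)
  also have "\<dots> = (\<Prod>s = 1..d. psum s ^ Poly_Mapping.lookup m s)"
    by (subst prod.distinct_set_conv_list[symmetric]) (simp_all add: atLeastLessThanSuc_atLeastAtMost del: upt_Suc)
  finally show ?thesis .
qed

lemma count_parts_list:
  "count (mset (parts_list d m)) s = (if s \<in> {1..d} then Poly_Mapping.lookup m s else 0)"
proof -
  have "count (mset (parts_list d m)) s = (\<Sum>t\<in>{1..<Suc d}. if t = s then Poly_Mapping.lookup m t else 0)"
    unfolding parts_list_def
    by (simp add: mset_concat comp_def sum_list_distinct_conv_sum_set count_sum del: upt_Suc cong: if_cong)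
  then show ?thesis by (auto simp: sum.delta)
qed

lemma parts_list_inject:
  assumes "mset (parts_list d m) = mset (parts_list d n)"
    and "Poly_Mapping.keys m \<subseteq> {1..d}" "Poly_Mapping.keys n \<subseteq> {1..d}"
  shows "m = n"
proof (rule poly_mapping_eqI)
  fix s
  show "Poly_Mapping.lookup m s = Poly_Mapping.lookup n s"
  proof (cases "s \<in> {1..d}")
    case True
    then show ?thesis using arg_cong[OF assms(1), of "\<lambda>M. count M s"] by (simp add: count_parts_list)
  next
    case False
    then show ?thesis using assms(2,3) by (metis in_keys_iff subsetD)
  qed
qed

section \<open>Algebraic independence of the power sums, and the coefficient sum\<close>

lemma mcoeff_sum: "mcoeff (sum f S) \<mu> = (\<Sum>x\<in>S. mcoeff (f x) \<mu>)"
  by (induction S rule: infinite_finite_induct) (auto simp: zero_mfps.rep_eq plus_mfps.rep_eq)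

text \<open>Among the products with nonzero coefficient, take one with the most parts. The monomial
  that gives each of its parts a variable of its own occurs in no other of these products, by
  \<open>placements_longest\<close>, so its coefficient isolates \<open>c n\<close>.\<close>

lemma psum_products_independent:
  fixes c :: "(nat \<Rightarrow>\<^sub>0 nat) \<Rightarrow> 'k :: field_char_0"
  assumes "finite S" "\<And>m. m \<in> S \<Longrightarrow> Poly_Mapping.keys m \<subseteq> {1..d}"
    and zero: "(\<Sum>m\<in>S. mscale (c m) (\<Prod>s = 1..d. psum s ^ Poly_Mapping.lookup m s)) = 0"
  shows "\<forall>m\<in>S. c m = 0"
proof (rule ccontr)
  let ?S = "{m \<in> S. c m \<noteq> 0}"
  let ?len = "\<lambda>m. length (parts_list d m)"
  assume "\<not> ?thesis"
  then have S: "finite ?S" "?S \<noteq> {}" using assms(1) by auto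
  have "Max (?len ` ?S) \<in> ?len ` ?S" using S by (intro Max_in) auto
  then obtain n where n: "n \<in> ?S" "?len n = Max (?len ` ?S)" by auto
  let ?\<mu> = "sum_list (map2 Poly_Mapping.single [0..<?len n] (parts_list d n))"
  have max: "?len m \<le> ?len n" if "m \<in> ?S" for m
    using that S(1) unfolding n(2) by (intro Max_ge) auto
  have eq: "m = n" if "m \<in> ?S" "placements (parts_list d m) ?\<mu> > 0" for m
    using placements_longest[OF parts_list_ge_1 parts_list_ge_1 max[OF that(1)] that(2)] that(1) n(1) assms(2)
    by (intro parts_list_inject) auto
  have "0 = mcoeff (\<Sum>m\<in>S. mscale (c m) (\<Prod>s = 1..d. psum s ^ Poly_Mapping.lookup m s)) ?\<mu>"
    by (simp only: zero zero_mfps.rep_eq)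
  also have "\<dots> = (\<Sum>m\<in>S. c m * of_nat (placements (parts_list d m) ?\<mu>))"
    by (simp add: mcoeff_sum mscale.rep_eq mcoeff_prod_list_psum[OF parts_list_ge_1] prod_list_parts_list[symmetric] del: One_nat_def)
  also have "\<dots> = (\<Sum>m\<in>{n}. c m * of_nat (placements (parts_list d m) ?\<mu>))"
    using n(1) assms(1) eq by (intro sum.mono_neutral_right) auto
  finally have "placements (parts_list d n) ?\<mu> = 0" using n(1) by simp
  \<comment> \<open>The placement witnessing this is the one used to build \<open>?\<mu>\<close>,
    sending the parts to the variables 0, 1, 2, ... in order.\<close>
  moreover have "placements (parts_list d n) ?\<mu> > 0"
    using placements_pos_iff[OF parts_list_ge_1, of d n ?\<mu>] by (metis diff_zero length_upt)
  ultimately show False by simp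
qed

text \<open>Terms can cancel in \<open>A + B\<close>, so its keys need not be those of
  \<open>A\<close> and \<open>B\<close> together; a common larger index set makes additivity
  termwise.\<close>

lemma eval_psum_superset:
  assumes "finite S" "Poly_Mapping.keys A \<subseteq> S"
  shows "eval_psum d A = (\<Sum>m\<in>S. mscale (Poly_Mapping.lookup A m) (\<Prod>s = 1..d. psum s ^ Poly_Mapping.lookup m s))"
  unfolding eval_psum_def using assms
  by (intro sum.mono_neutral_left) (auto simp: in_keys_iff mscale_def zero_mfps_def)

lemma eval_psum_add: "eval_psum d (A + B) = eval_psum d A + eval_psum d B"
proof -
  let ?S = "Poly_Mapping.keys A \<union> Poly_Mapping.keys B"
  have "finite ?S" "Poly_Mapping.keys (A + B) \<subseteq> ?S" using keys_add[of A B] by auto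
  moreover have "mscale (x + y) F = mscale x F + mscale y F" for x y :: 'a and F
    by (rule mfps_eqI) (simp add: mscale.rep_eq plus_mfps.rep_eq distrib_right)
  ultimately show ?thesis
    by (simp add: eval_psum_superset[of ?S] lookup_add sum.distrib)
qed

lemma eval_psum_single:
  "eval_psum d (Poly_Mapping.single m c) = mscale c (\<Prod>s = 1..d. psum s ^ Poly_Mapping.lookup m s)"
  by (subst eval_psum_superset[of "{m}"]) auto

lemma eval_psum_inject:
  fixes A B :: "(nat \<Rightarrow>\<^sub>0 nat) \<Rightarrow>\<^sub>0 'k :: field_char_0"
  assumes "\<forall>m\<in>Poly_Mapping.keys A. Poly_Mapping.keys m \<subseteq> {1..d}"
    and "\<forall>m\<in>Poly_Mapping.keys B. Poly_Mapping.keys m \<subseteq> {1..d}"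
    and "eval_psum d A = eval_psum d B"
  shows "A = B"
proof -
  have C: "Poly_Mapping.keys (A - B) \<subseteq> Poly_Mapping.keys A \<union> Poly_Mapping.keys B"
    using keys_diff[of A B] .
  have "eval_psum d A = eval_psum d (A - B) + eval_psum d B" by (metis diff_add_cancel eval_psum_add)
  then have "eval_psum d (A - B) = 0" using assms(3) by simp
  then have "\<forall>m\<in>Poly_Mapping.keys (A - B). Poly_Mapping.lookup (A - B) m = 0"
    using C assms(1,2) unfolding eval_psum_def by (intro psum_products_independent[of _ d]) auto
  then have "A - B = 0" by (metis in_keys_iff keys_eq_empty equals0I)
  then show ?thesis by simp
qed

text \<open>The uniqueness demanded by \<open>THE\<close> is \<open>eval_psum_inject\<close>: any
  other admissible polynomial with the same value is \<open>A\<close> itself.\<close>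

lemma coeff_sum_eval_psum:
  fixes A :: "(nat \<Rightarrow>\<^sub>0 nat) \<Rightarrow>\<^sub>0 'k :: field_char_0"
  assumes "\<forall>m\<in>Poly_Mapping.keys A. Poly_Mapping.keys m \<subseteq> {1..d}"
  shows "coeff_sum d (eval_psum d A) = (\<Sum>m\<in>Poly_Mapping.keys A. Poly_Mapping.lookup A m)"
  unfolding coeff_sum_def using assms eval_psum_inject by (intro the_equality) blast+

section \<open>Cycle types and conjugacy\<close>

text \<open>The period of a point is the length of its cycle. This lets points of two cycles of
  equal length be matched by exponents that are only determined modulo that length.\<close>

lemma funpow_eq_iff_mod_card_orbit:
  assumes "permutation f"
  shows "(f ^^ i) x = (f ^^ j) x \<longleftrightarrow> i mod card (orbit f x) = j mod card (orbit f x)"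
proof -
  have x: "x \<in> orbit f x" using permutation_self_in_orbit[OF assms] .
  define p where "p = funpow_dist1 f x x"
  have inj: "inj_on (\<lambda>n. (f ^^ n) x) {0..<p}"
    using inj_on_funpow_dist1[OF x] by (simp add: p_def)
  have "orbit f x = (\<lambda>n. (f ^^ n) x) ` {0..<p}"
    using orbit_conv_funpow_dist1[OF x] by (simp add: p_def)
  then have card: "card (orbit f x) = p" using card_image[OF inj] by simp
  have period: "(f ^^ (n mod p)) x = (f ^^ n) x" for n
    using funpow_dist1_prop[OF x] unfolding p_def by (rule funpow_mod_eq)
  have "p > 0" by (simp add: p_def)
  then have "i mod p = j mod p" if "(f ^^ (i mod p)) x = (f ^^ (j mod p)) x"
    using inj_onD[OF inj that] by simp
  then show ?thesis using period card by metis
qed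

text \<open>Bijections between the members of each fixed size are glued together. For sets of cycles
  this is the matching of cycles of equal length.\<close>

lemma bij_betw_card_preserving:
  assumes "finite A" "finite B"
    and eq: "\<And>s. card {C \<in> A. card C = s} = card {C \<in> B. card C = s}"
  shows "\<exists>\<beta>. bij_betw \<beta> A B \<and> (\<forall>C\<in>A. card (\<beta> C) = card C)"
proof -
  have "\<exists>g. bij_betw g {C \<in> A. card C = s} {C \<in> B. card C = s}" for s
    using assms by (intro finite_same_card_bij) auto
  then obtain g where g: "\<And>s. bij_betw (g s) {C \<in> A. card C = s} {C \<in> B. card C = s}" by metis
  define \<beta> where "\<beta> C = g (card C) C" for C
  have \<beta>: "\<beta> C \<in> B \<and> card (\<beta> C) = card C" if "C \<in> A" for C
    using bij_betwE[OF g[of "card C"]] that by (auto simp: \<beta>_def)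
  have "inj_on \<beta> A"
  proof (rule inj_onI)
    fix C D assume CD: "C \<in> A" "D \<in> A" "\<beta> C = \<beta> D"
    then have "card C = card D" using \<beta> by metis
    then show "C = D"
      using CD bij_betw_imp_inj_on[OF g[of "card D"]] by (auto simp: \<beta>_def dest: inj_onD)
  qed
  moreover have "B \<subseteq> \<beta> ` A"
  proof
    fix D assume "D \<in> B"
    then have "D \<in> g (card D) ` {C \<in> A. card C = card D}"
      using bij_betw_imp_surj_on[OF g[of "card D"]] by auto
    then obtain C where "C \<in> A" "card C = card D" "D = g (card D) C" by blast
    then have "C \<in> A" "D = \<beta> C" by (simp_all add: \<beta>_def)
    then show "D \<in> \<beta> ` A" by blast
  qed
  ultimately have "bij_betw \<beta> A B" using \<beta> by (auto simp: bij_betw_def)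
  then show ?thesis using \<beta> by blast
qed

text \<open>The conjugating permutation matches up the cycles of equal length and then follows both
  permutations from chosen base points of matching cycles.\<close>

lemma ex_permutes_conjugate:
  assumes \<sigma>: "\<sigma> permutes S" and \<tau>: "\<tau> permutes S" and S: "finite S"
    and \<beta>: "bij_betw \<beta> (orbit \<sigma> ` S) (orbit \<tau> ` S)" "\<And>C. C \<in> orbit \<sigma> ` S \<Longrightarrow> card (\<beta> C) = card C"
  shows "\<exists>\<zeta>. \<zeta> permutes S \<and> \<zeta> \<circ> \<sigma> = \<tau> \<circ> \<zeta>"
proof -
  have perm: "permutation \<sigma>" "permutation \<tau>" using \<sigma> \<tau> S by (auto simp: permutation_permutes)
  define x y where "x C = (SOME z. z \<in> C)" and "y C = (SOME z. z \<in> \<beta> C)" for C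
  have orbit_nonempty: "orbit f z \<noteq> {}" for f and z :: 'a by (rule orbit_nonempty)
  have orbit_eq: "orbit f w = orbit f z" if "permutation f" "w \<in> orbit f z" for f and w z :: 'a
    using orbit_cyclic_eq3[OF cyclic_on_orbit'] that by metis
  have x: "x C \<in> C" "orbit \<sigma> (x C) = C" and y: "y C \<in> \<beta> C" "orbit \<tau> (y C) = \<beta> C"
    if "C \<in> orbit \<sigma> ` S" for C
  proof -
    show "x C \<in> C" using that orbit_nonempty by (auto simp: x_def some_in_eq)
    then show "orbit \<sigma> (x C) = C" using that orbit_eq perm by blast
    have \<beta>C: "\<beta> C \<in> orbit \<tau> ` S" using \<beta>(1) that by (auto simp: bij_betw_def)
    then show "y C \<in> \<beta> C" using orbit_nonempty by (auto simp: y_def some_in_eq)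
    then show "orbit \<tau> (y C) = \<beta> C" using \<beta>C orbit_eq perm by blast
  qed
  define \<zeta> where "\<zeta> z = (if z \<in> S then
      (\<tau> ^^ funpow_dist \<sigma> (x (orbit \<sigma> z)) z) (y (orbit \<sigma> z)) else z)" for z
  have self: "z \<in> orbit \<sigma> z" for z using permutation_self_in_orbit perm by metis
  have ex: "\<exists>i. z = (\<sigma> ^^ i) (x (orbit \<sigma> z))" if "z \<in> S" for z
    using orbit_altdef_permutation[OF perm(1), of "x (orbit \<sigma> z)"] x(2)[of "orbit \<sigma> z"] self that by auto
  have in_S: "orbit \<sigma> z \<subseteq> S" "orbit \<tau> z \<subseteq> S" if "z \<in> S" for z
    using permutes_orbit_subset that \<sigma> \<tau> by metis+
  \<comment> \<open>The exponent picked by \<open>funpow_dist\<close> agrees with i only modulo the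
    length of C, which suffices because the matched \<tau>-cycle has the same length.\<close>
  have \<zeta>: "\<zeta> ((\<sigma> ^^ i) (x C)) = (\<tau> ^^ i) (y C)" if C: "C \<in> orbit \<sigma> ` S" for C i
  proof -
    let ?z = "(\<sigma> ^^ i) (x C)"
    have z: "?z \<in> C" using x[OF C] funpow_in_orbit[of "x C" \<sigma> "x C" i] by simp
    then have zS: "?z \<in> S" using C in_S by blast
    have zC: "orbit \<sigma> ?z = C" using z C orbit_eq perm by blast
    have "(\<sigma> ^^ funpow_dist \<sigma> (x C) ?z) (x C) = ?z"
      using z x(2)[OF C] by (intro funpow_dist_prop) simp
    then have "funpow_dist \<sigma> (x C) ?z mod card C = i mod card C"
      using funpow_eq_iff_mod_card_orbit[OF perm(1), of _ "x C"] x(2)[OF C] by simp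
    then show ?thesis
      using funpow_eq_iff_mod_card_orbit[OF perm(2), of _ "y C" i] y(2)[OF C] \<beta>(2)[OF C] zS zC
      by (simp add: \<zeta>_def)
  qed
  have comm: "\<zeta> (\<sigma> z) = \<tau> (\<zeta> z)" for z
  proof (cases "z \<in> S")
    case True
    then obtain i where i: "z = (\<sigma> ^^ i) (x (orbit \<sigma> z))" using ex[OF True] by blast
    define C where "C = orbit \<sigma> z"
    have C: "C \<in> orbit \<sigma> ` S" using True by (simp add: C_def)
    have "z = (\<sigma> ^^ i) (x C)" using i by (simp add: C_def)
    then show ?thesis using \<zeta>[OF C, of i] \<zeta>[OF C, of "Suc i"] by simp
  next
    case False
    then show ?thesis using \<sigma> \<tau> by (simp add: \<zeta>_def permutes_not_in)
  qed
  have \<zeta>_in: "\<zeta> z \<in> \<beta> (orbit \<sigma> z)" if z: "z \<in> S" for z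
  proof -
    obtain i where i: "z = (\<sigma> ^^ i) (x (orbit \<sigma> z))" using ex[OF z] by blast
    have "\<zeta> ((\<sigma> ^^ i) (x (orbit \<sigma> z))) = (\<tau> ^^ i) (y (orbit \<sigma> z))" using z by (intro \<zeta>) simp
    then have "\<zeta> z = (\<tau> ^^ i) (y (orbit \<sigma> z))" by (simp flip: i)
    then show ?thesis using y[of "orbit \<sigma> z"] z funpow_in_orbit[of "y (orbit \<sigma> z)" \<tau>] by auto
  qed
  have "inj_on \<zeta> S"
  proof (rule inj_onI)
    fix z w assume zw: "z \<in> S" "w \<in> S" "\<zeta> z = \<zeta> w"
    \<comment> \<open>The common image lies in both matched cycles. Cycles sharing a point coincide,
      and \<beta> is injective, so z and w lie in one \<sigma>-cycle.\<close>
    have "\<beta> (orbit \<sigma> z) \<in> orbit \<tau> ` S" "\<beta> (orbit \<sigma> w) \<in> orbit \<tau> ` S"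
      using \<beta>(1) zw by (auto simp: bij_betw_def)
    then have "\<beta> (orbit \<sigma> z) = \<beta> (orbit \<sigma> w)"
      using \<zeta>_in[of z] \<zeta>_in[of w] zw orbit_eq[OF perm(2)] by (smt (verit) imageE)
    then have eq: "orbit \<sigma> z = orbit \<sigma> w"
      using \<beta>(1) zw by (auto simp: bij_betw_def dest: inj_onD)
    obtain i j where ij: "z = (\<sigma> ^^ i) (x (orbit \<sigma> z))" "w = (\<sigma> ^^ j) (x (orbit \<sigma> w))" using ex zw by meson
    define C where "C = orbit \<sigma> z"
    have C: "C \<in> orbit \<sigma> ` S" using zw by (simp add: C_def)
    have ij': "z = (\<sigma> ^^ i) (x C)" "w = (\<sigma> ^^ j) (x C)" using ij eq by (simp_all add: C_def)
    then have "(\<tau> ^^ i) (y C) = (\<tau> ^^ j) (y C)" using zw(3) \<zeta>[OF C] by metis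
    then show "z = w"
      using funpow_eq_iff_mod_card_orbit[OF perm(2), of i "y C" j]
        funpow_eq_iff_mod_card_orbit[OF perm(1), of i "x C" j] x(2)[OF C] y(2)[OF C] \<beta>(2)[OF C] ij' by simp
  qed
  moreover have "\<zeta> ` S \<subseteq> S"
  proof safe
    fix z assume z: "z \<in> S"
    then have "\<beta> (orbit \<sigma> z) \<in> orbit \<tau> ` S" using \<beta>(1) by (auto simp: bij_betw_def)
    then show "\<zeta> z \<in> S" using \<zeta>_in[OF z] in_S(2) by auto
  qed
  ultimately have "bij_betw \<zeta> S S"
    using S by (simp add: bij_betw_def endo_inj_surj)
  then have "\<zeta> permutes S" by (rule bij_imp_permutes) (simp add: \<zeta>_def)
  moreover have "\<zeta> \<circ> \<sigma> = \<tau> \<circ> \<zeta>" using comm by (simp add: fun_eq_iff)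
  ultimately show ?thesis by blast
qed

lemma num_cycles_eq_0:
  assumes "\<sigma> permutes {1..d}" "s \<notin> {1..d}"
  shows "num_cycles d s \<sigma> = 0"
proof -
  have "card C \<in> {1..d}" if "C \<in> orbit \<sigma> ` {1..d}" for C
  proof -
    have "C \<subseteq> {1..d}" using that permutes_orbit_subset[OF assms(1)] by blast
    moreover have "C \<noteq> {}" using that orbit_nonempty[of \<sigma>] by blast
    ultimately show ?thesis
      using card_mono[of "{1..d}" C] finite_subset[of C "{1..d}"] by (simp add: Suc_le_eq card_gt_0_iff)
  qed
  then show ?thesis using assms(2) by (auto simp: num_cycles_def card_eq_0_iff)
qed

lemma conjugate_if_num_cycles_eq:
  assumes "\<sigma> permutes {1..d}" "\<tau> permutes {1..d}"
    and "\<And>s. s \<in> {1..d} \<Longrightarrow> num_cycles d s \<sigma> = num_cycles d s \<tau>"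
  shows "\<exists>\<zeta>. \<zeta> permutes {1..d} \<and> \<zeta> \<circ> \<sigma> = \<tau> \<circ> \<zeta>"
proof -
  have "num_cycles d s \<sigma> = num_cycles d s \<tau>" for s
    using assms num_cycles_eq_0 by metis
  then have "\<exists>\<beta>. bij_betw \<beta> (orbit \<sigma> ` {1..d}) (orbit \<tau> ` {1..d}) \<and>
      (\<forall>C\<in>orbit \<sigma> ` {1..d}. card (\<beta> C) = card C)"
    by (intro bij_betw_card_preserving) (auto simp: num_cycles_def)
  then show ?thesis using ex_permutes_conjugate[OF assms(1,2)] by blast
qed

text \<open>\<zeta> carries the cycles of \<sigma> bijectively onto those of \<tau> and preserves
  their lengths.\<close>

lemma num_cycles_conjugate:
  assumes "\<sigma> permutes {1..d}" "\<zeta> permutes {1..d}" "\<zeta> \<circ> \<sigma> = \<tau> \<circ> \<zeta>"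
  shows "num_cycles d s \<tau> = num_cycles d s \<sigma>"
proof -
  have "permutation \<sigma>" using assms(1) by (auto simp: permutation_permutes)
  then have orbit: "\<zeta> ` orbit \<sigma> i = orbit \<tau> (\<zeta> i)" for i
    using assms(3) by (intro orbit_inverse permutation_self_in_orbit) (simp_all add: fun_eq_iff)
  have "orbit \<tau> ` {1..d} = orbit \<tau> ` \<zeta> ` {1..d}" using permutes_image[OF assms(2)] by simp
  also have "\<dots> = (`) \<zeta> ` orbit \<sigma> ` {1..d}" by (simp add: image_image orbit)
  finally have eq: "orbit \<tau> ` {1..d} = (`) \<zeta> ` orbit \<sigma> ` {1..d}" .
  have inj: "inj \<zeta>" using permutes_inj[OF assms(2)] .
  have card: "card (\<zeta> ` C) = card C" for C using inj by (simp add: card_image inj_on_subset)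
  then have "{C \<in> orbit \<tau> ` {1..d}. card C = s} = (`) \<zeta> ` {C \<in> orbit \<sigma> ` {1..d}. card C = s}"
    unfolding eq by auto
  moreover have "inj_on ((`) \<zeta>) A" for A using inj by (simp add: inj_on_def inj_image_eq_iff)
  ultimately show ?thesis by (simp add: num_cycles_def card_image)
qed

section \<open>Characters of the symmetric group\<close>

text \<open>Matrix representations with rows and columns indexed by an arbitrary finite set, so that
  tensor products and transversals need no enumeration.\<close>

definition index_rep :: "nat \<Rightarrow> 'x set \<Rightarrow> ((nat \<Rightarrow> nat) \<Rightarrow> 'x \<Rightarrow> 'x \<Rightarrow> 'k :: field) \<Rightarrow> bool" where
  "index_rep d I R \<longleftrightarrow> finite I \<and>
    (\<forall>x\<in>I. \<forall>y\<in>I. R id x y = (if x = y then 1 else 0)) \<and>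
    (\<forall>\<sigma>\<in>carrier (sym_group d). \<forall>\<tau>\<in>carrier (sym_group d). \<forall>x\<in>I. \<forall>z\<in>I.
      R (\<sigma> \<circ> \<tau>) x z = (\<Sum>y\<in>I. R \<sigma> x y * R \<tau> y z))"

section \<open>Translation between matrix representations and \<open>index_rep\<close>\<close>

lemma Units_ring_mat:
  "A \<in> Units (ring_mat TYPE('k :: field) n ()) \<longleftrightarrow>
    A \<in> carrier_mat n n \<and> (\<exists>B\<in>carrier_mat n n. B * A = 1\<^sub>m n \<and> A * B = 1\<^sub>m n)"
  by (auto simp: Units_def ring_mat_def)

lemma carrier_GL: "carrier (GL n) = Units (ring_mat TYPE('k :: field) n ())"
  by (simp add: units_of_def)

lemma mult_GL: "A \<otimes>\<^bsub>GL n\<^esub> B = A * (B :: 'k :: field mat)"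
  by (simp add: units_of_def ring_mat_def)

lemma one_GL: "\<one>\<^bsub>GL n\<^esub> = (1\<^sub>m n :: 'k :: field mat)"
  by (simp add: units_of_def ring_mat_def)

lemma group_GL: "group (GL n :: 'k :: field mat monoid)"
proof -
  interpret R: ring "ring_mat TYPE('k) n ()" by (rule ring_mat)
  show ?thesis by (rule R.units_group)
qed

text \<open>An enumeration \<open>e\<close> of the index set turns R into honest matrices without
  changing the trace. Invertibility is not part of \<open>index_rep\<close>; it follows from
  multiplicativity and the value at the identity.\<close>

lemma index_rep_imp_sym_character:
  assumes R: "index_rep d I R"
  shows "(\<lambda>\<sigma>\<in>carrier (sym_group d). \<Sum>x\<in>I. R \<sigma> x x) \<in> sym_characters d"
proof -
  interpret G: group "sym_group d" by (rule sym_group_is_group)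
  have "finite I" using R by (simp add: index_rep_def)
  then obtain e where e: "bij_betw e {..<card I} I"
    using ex_bij_betw_nat_finite by (metis atLeast0LessThan)
  let ?n = "card I"
  define r where "r \<sigma> = mat ?n ?n (\<lambda>(i, j). R \<sigma> (e i) (e j))" for \<sigma>
  have eX: "e i \<in> I" if "i < ?n" for i using e that by (auto simp: bij_betw_def)
  have one: "r id = 1\<^sub>m ?n"
    using R e eX by (intro eq_matI) (auto simp: r_def index_rep_def bij_betw_def inj_on_def)
  have mult: "r (\<sigma> \<circ> \<tau>) = r \<sigma> * r \<tau>" if "\<sigma> \<in> carrier (sym_group d)" "\<tau> \<in> carrier (sym_group d)" for \<sigma> \<tau>
  proof (intro eq_matI)
    fix i j assume "i < dim_row (r \<sigma> * r \<tau>)" "j < dim_col (r \<sigma> * r \<tau>)"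
    then have ij: "i < ?n" "j < ?n" by (simp_all add: r_def)
    have "r (\<sigma> \<circ> \<tau>) $$ (i, j) = (\<Sum>y\<in>I. R \<sigma> (e i) y * R \<tau> y (e j))"
      using ij R that eX by (simp add: r_def index_rep_def)
    also have "\<dots> = (\<Sum>l<?n. R \<sigma> (e i) (e l) * R \<tau> (e l) (e j))"
      by (rule sum.reindex_bij_betw[OF e, symmetric])
    also have "\<dots> = (r \<sigma> * r \<tau>) $$ (i, j)"
      using ij by (simp add: r_def scalar_prod_def atLeast0LessThan)
    finally show "r (\<sigma> \<circ> \<tau>) $$ (i, j) = (r \<sigma> * r \<tau>) $$ (i, j)" .
  qed (simp_all add: r_def)
  have "r \<sigma> \<in> Units (ring_mat TYPE('b) ?n ())" if \<sigma>: "\<sigma> \<in> carrier (sym_group d)" for \<sigma>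
  proof -
    have \<sigma>': "inv' \<sigma> \<in> carrier (sym_group d)" using \<sigma> by (rule sym_group_inv_closed)
    have "\<sigma> \<circ> inv' \<sigma> = id" "inv' \<sigma> \<circ> \<sigma> = id"
      using \<sigma> by (simp_all add: sym_group_carrier permutes_inv_o)
    then have "r \<sigma> * r (inv' \<sigma>) = 1\<^sub>m ?n" "r (inv' \<sigma>) * r \<sigma> = 1\<^sub>m ?n"
      using mult \<sigma> \<sigma>' one by metis+
    then show ?thesis unfolding Units_ring_mat by (auto simp: r_def)
  qed
  then have "r \<in> hom (sym_group d) (GL ?n)"
    using mult by (auto simp: hom_def carrier_GL mult_GL sym_group_mult)
  moreover have "mat_trace (r \<sigma>) = (\<Sum>x\<in>I. R \<sigma> x x)" for \<sigma>
    using sum.reindex_bij_betw[OF e, of "\<lambda>x. R \<sigma> x x"] by (simp add: mat_trace_def r_def)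
  ultimately show ?thesis unfolding sym_characters_def
    by (intro CollectI exI[of _ ?n] exI[of _ r]) (auto intro!: restrict_ext)
qed

lemma sym_character_imp_index_rep:
  assumes "\<phi> \<in> sym_characters d"
  shows "\<exists>n R. index_rep d {..<n :: nat} R \<and> \<phi> = (\<lambda>\<sigma>\<in>carrier (sym_group d). \<Sum>x<n. R \<sigma> x x)"
proof -
  obtain n r where r: "r \<in> hom (sym_group d) (GL n)" "\<phi> = (\<lambda>\<sigma>\<in>carrier (sym_group d). mat_trace (r \<sigma>))"
    using assms by (auto simp: sym_characters_def)
  have carrier: "r \<sigma> \<in> carrier_mat n n" if "\<sigma> \<in> carrier (sym_group d)" for \<sigma>
    using hom_in_carrier[OF r(1) that] by (simp add: carrier_GL Units_ring_mat)
  have one: "r id = 1\<^sub>m n"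
    using hom_one[OF r(1) sym_group_is_group group_GL] by (simp add: sym_group_one one_GL)
  have mult: "r (\<sigma> \<circ> \<tau>) = r \<sigma> * r \<tau>" if "\<sigma> \<in> carrier (sym_group d)" "\<tau> \<in> carrier (sym_group d)" for \<sigma> \<tau>
    using hom_mult[OF r(1) that] by (simp add: sym_group_mult mult_GL)
  have "index_rep d {..<n} (\<lambda>\<sigma> i j. r \<sigma> $$ (i, j))"
    unfolding index_rep_def
  proof (intro conjI ballI)
    fix \<sigma> \<tau> i j
    assume \<sigma>: "\<sigma> \<in> carrier (sym_group d)" and \<tau>: "\<tau> \<in> carrier (sym_group d)" and "i \<in> {..<n}" "j \<in> {..<n}"
    then show "r (\<sigma> \<circ> \<tau>) $$ (i, j) = (\<Sum>y<n. r \<sigma> $$ (i, y) * r \<tau> $$ (y, j))"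
      using carrier[OF \<sigma>] carrier[OF \<tau>] by (simp add: mult scalar_prod_def atLeast0LessThan)
  qed (simp_all add: one)
  moreover have "mat_trace (r \<sigma>) = (\<Sum>i<n. r \<sigma> $$ (i, i))" if "\<sigma> \<in> carrier (sym_group d)" for \<sigma>
    using carrier[OF that] by (simp add: mat_trace_def)
  ultimately show ?thesis using r(2)
    by (intro exI[of _ n] exI[of _ "\<lambda>\<sigma> i j. r \<sigma> $$ (i, j)"]) (auto intro!: restrict_ext)
qed

text \<open>The tensor product: \<open>T\<close> is the Kronecker product on pairs of indices, and
  its trace is the product of the two traces.\<close>

lemma sym_characters_mult:
  assumes "\<phi> \<in> sym_characters d" "\<psi> \<in> sym_characters d"
  shows "(\<lambda>\<sigma>\<in>carrier (sym_group d). \<phi> \<sigma> * \<psi> \<sigma>) \<in> sym_characters d"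
proof -
  obtain n R where R: "index_rep d {..<n :: nat} R" "\<phi> = (\<lambda>\<sigma>\<in>carrier (sym_group d). \<Sum>x<n. R \<sigma> x x)"
    using sym_character_imp_index_rep[OF assms(1)] by blast
  obtain m Q where Q: "index_rep d {..<m :: nat} Q" "\<psi> = (\<lambda>\<sigma>\<in>carrier (sym_group d). \<Sum>x<m. Q \<sigma> x x)"
    using sym_character_imp_index_rep[OF assms(2)] by blast
  define T where "T \<sigma> p q = R \<sigma> (fst p) (fst q) * Q \<sigma> (snd p) (snd q)" for \<sigma> p q
  have "index_rep d ({..<n} \<times> {..<m}) T"
    unfolding index_rep_def
  proof (intro conjI ballI)
    fix \<sigma> \<tau> p q
    assume "\<sigma> \<in> carrier (sym_group d)" "\<tau> \<in> carrier (sym_group d)"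
      "p \<in> {..<n} \<times> {..<m}" "q \<in> {..<n} \<times> {..<m}"
    then have "T (\<sigma> \<circ> \<tau>) p q =
        (\<Sum>i<n. R \<sigma> (fst p) i * R \<tau> i (fst q)) * (\<Sum>j<m. Q \<sigma> (snd p) j * Q \<tau> j (snd q))"
      using R(1) Q(1) unfolding index_rep_def T_def by auto
    also have "\<dots> = (\<Sum>y\<in>{..<n} \<times> {..<m}. T \<sigma> p y * T \<tau> y q)"
      by (simp only: sum_product sum.cartesian_product) (simp add: T_def case_prod_unfold ac_simps)
    finally show "T (\<sigma> \<circ> \<tau>) p q = (\<Sum>y\<in>{..<n} \<times> {..<m}. T \<sigma> p y * T \<tau> y q)" .
  next
    fix p q assume "p \<in> {..<n} \<times> {..<m}" "q \<in> {..<n} \<times> {..<m}"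
    then have "R id (fst p) (fst q) = (if fst p = fst q then 1 else 0)"
      "Q id (snd p) (snd q) = (if snd p = snd q then 1 else 0)"
      using R(1) Q(1) unfolding index_rep_def by auto
    then show "T id p q = (if p = q then 1 else 0)" by (auto simp: T_def prod_eq_iff)
  qed simp
  then have "(\<lambda>\<sigma>\<in>carrier (sym_group d). \<Sum>p\<in>{..<n} \<times> {..<m}. T \<sigma> p p) \<in> sym_characters d"
    by (rule index_rep_imp_sym_character)
  moreover have "(\<Sum>p\<in>{..<n} \<times> {..<m}. T \<sigma> p p) = \<phi> \<sigma> * \<psi> \<sigma>" if "\<sigma> \<in> carrier (sym_group d)" for \<sigma>
    using that unfolding R(2) Q(2)
    by (simp add: sum_product sum.cartesian_product T_def case_prod_unfold)
  ultimately show ?thesis by (simp cong: restrict_cong)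
qed

lemma sym_characters_subset_gen_characters: "sym_characters d \<subseteq> gen_characters d"
proof
  fix \<phi> :: "(nat \<Rightarrow> nat) \<Rightarrow> 'k :: field" assume \<phi>: "\<phi> \<in> sym_characters d"
  \<comment> \<open>The zero-dimensional representation supplies the zero character to be
    subtracted.\<close>
  have "index_rep d {} (\<lambda>_ (_ :: nat) _. 0 :: 'k)" by (simp add: index_rep_def)
  from index_rep_imp_sym_character[OF this]
  have zero: "(\<lambda>\<sigma>\<in>carrier (sym_group d). 0 :: 'k) \<in> sym_characters d" by simp
  have "\<phi> = restrict \<phi> (carrier (sym_group d))" using \<phi> by (auto simp: sym_characters_def)
  also have "\<dots> = (\<lambda>\<sigma>\<in>carrier (sym_group d). \<phi> \<sigma> - (\<lambda>\<sigma>\<in>carrier (sym_group d). 0) \<sigma>)"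
    by (rule restrict_ext) simp
  finally have "\<phi> = (\<lambda>\<sigma>\<in>carrier (sym_group d). \<phi> \<sigma> - (\<lambda>\<sigma>\<in>carrier (sym_group d). 0) \<sigma>)" .
  then show "\<phi> \<in> gen_characters d" using \<phi> zero unfolding gen_characters_def by blast
qed

text \<open>The identity tr(AB) = tr(BA), applied to the inverse of \<zeta> and to \<zeta> \<circ>
  \<sigma>.\<close>

lemma sym_characters_conjugate:
  assumes "\<phi> \<in> sym_characters d" "\<sigma> \<in> carrier (sym_group d)" "\<tau> \<in> carrier (sym_group d)"
    "\<zeta> \<in> carrier (sym_group d)" "\<zeta> \<circ> \<sigma> = \<tau> \<circ> \<zeta>"
  shows "\<phi> \<sigma> = \<phi> \<tau>"
proof -
  obtain n R where R: "index_rep d {..<n :: nat} R" "\<phi> = (\<lambda>\<sigma>\<in>carrier (sym_group d). \<Sum>x<n. R \<sigma> x x)"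
    using sym_character_imp_index_rep[OF assms(1)] by blast
  have trace_comm: "\<phi> (\<alpha> \<circ> \<beta>) = \<phi> (\<beta> \<circ> \<alpha>)"
    if "\<alpha> \<in> carrier (sym_group d)" "\<beta> \<in> carrier (sym_group d)" for \<alpha> \<beta>
  proof -
    have "\<alpha> \<circ> \<beta> \<in> carrier (sym_group d)" "\<beta> \<circ> \<alpha> \<in> carrier (sym_group d)"
      using that by (auto simp: sym_group_carrier permutes_compose)
    moreover have "(\<Sum>x<n. \<Sum>y<n. R \<alpha> x y * R \<beta> y x) = (\<Sum>x<n. \<Sum>y<n. R \<beta> x y * R \<alpha> y x)"
      by (subst sum.swap) (simp add: mult.commute)
    ultimately show ?thesis using R(1) that by (simp add: R(2) index_rep_def)
  qed
  have \<zeta>: "inv' \<zeta> \<in> carrier (sym_group d)" using assms(4) by (rule sym_group_inv_closed)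
  have inv: "inv' \<zeta> \<circ> \<zeta> = id" "\<zeta> \<circ> inv' \<zeta> = id"
    using assms(4) by (simp_all add: sym_group_carrier permutes_inv_o)
  have "\<phi> \<sigma> = \<phi> (inv' \<zeta> \<circ> (\<zeta> \<circ> \<sigma>))" using inv by (simp add: comp_assoc[symmetric])
  also have "\<dots> = \<phi> ((\<zeta> \<circ> \<sigma>) \<circ> inv' \<zeta>)"
    using \<zeta> assms by (intro trace_comm) (auto simp: sym_group_carrier permutes_compose)
  also have "\<dots> = \<phi> \<tau>" using assms(5) inv by (simp add: comp_assoc)
  finally show ?thesis .
qed

lemma gen_characters_conjugate:
  assumes "\<phi> \<in> gen_characters d" "\<sigma> \<in> carrier (sym_group d)" "\<tau> \<in> carrier (sym_group d)"
    "\<zeta> \<in> carrier (sym_group d)" "\<zeta> \<circ> \<sigma> = \<tau> \<circ> \<zeta>"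
  shows "\<phi> \<sigma> = \<phi> \<tau>"
proof -
  obtain \<alpha> \<beta> where \<alpha>: "\<alpha> \<in> sym_characters d" and \<beta>: "\<beta> \<in> sym_characters d"
    and \<phi>: "\<phi> = (\<lambda>\<sigma>\<in>carrier (sym_group d). \<alpha> \<sigma> - \<beta> \<sigma>)"
    using assms(1) by (auto simp: gen_characters_def)
  show ?thesis
    using sym_characters_conjugate[OF \<alpha> assms(2-)] sym_characters_conjugate[OF \<beta> assms(2-)] assms(2,3)
    by (simp add: \<phi>)
qed

section \<open>Induced characters\<close>

text \<open>The extension by zero that occurs in the Frobenius formula for induced
  characters.\<close>

definition extend_zero :: "'g set \<Rightarrow> ('g \<Rightarrow> 'k :: zero) \<Rightarrow> 'g \<Rightarrow> 'k" where
  "extend_zero H \<chi> g = (if g \<in> H then \<chi> g else 0)"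

section \<open>Left transversals and the monomial matrices of an induced representation\<close>

context group
begin

lemma inv_mult_in_iff_l_coset_eq:
  assumes "subgroup H G" "t \<in> carrier G" "g \<in> carrier G"
  shows "inv t \<otimes> g \<in> H \<longleftrightarrow> t <# H = g <# H"
proof
  assume "inv t \<otimes> g \<in> H"
  then have "t \<otimes> (inv t \<otimes> g) \<in> t <# H" by (auto simp: l_coset_def)
  then have "g \<in> t <# H" using assms by (simp add: inv_solve_left m_assoc[symmetric])
  then show "t <# H = g <# H" using assms l_repr_independence by blast
next
  assume "t <# H = g <# H"
  moreover have "g \<otimes> \<one> \<in> g <# H"
    using subgroup.one_closed[OF assms(1)] by (auto simp: l_coset_def)
  ultimately have "g \<in> t <# H" using assms by simp
  then obtain h where "h \<in> H" "g = t \<otimes> h" by (auto simp: l_coset_def)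
  then show "inv t \<otimes> g \<in> H"
    using assms subgroup.mem_carrier[OF assms(1)] by (simp add: m_assoc[symmetric])
qed

text \<open>T represents the left cosets of H. The unique-existence form is what lets
  \<open>sum_transversal\<close> pick out a single surviving summand.\<close>

lemma ex_transversal:
  assumes "subgroup H G"
  shows "\<exists>T \<subseteq> carrier G. \<forall>g\<in>carrier G. \<exists>!t. t \<in> T \<and> inv t \<otimes> g \<in> H"
proof -
  define rep where "rep A = (SOME x. x \<in> A)" for A :: "'a set"
  \<comment> \<open>T consists of the elements that are the chosen representatives of their own
    cosets.\<close>
  define T where "T = {t \<in> carrier G. t = rep (t <# H)}"
  have "\<exists>!t. t \<in> T \<and> inv t \<otimes> g \<in> H" if g: "g \<in> carrier G" for g
  proof
    have "g \<otimes> \<one> \<in> g <# H"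
      using subgroup.one_closed[OF assms(1)] by (auto simp: l_coset_def)
    then have rep: "rep (g <# H) \<in> g <# H" unfolding rep_def by (rule someI)
    then have "rep (g <# H) \<in> carrier G"
      using g assms l_coset_subset_G subgroup.subset by blast
    moreover have "rep (g <# H) <# H = g <# H"
      using l_repr_independence[OF rep g assms] by simp
    ultimately show "rep (g <# H) \<in> T \<and> inv (rep (g <# H)) \<otimes> g \<in> H"
      using g inv_mult_in_iff_l_coset_eq[OF assms] by (simp add: T_def)
  next
    fix t assume "t \<in> T \<and> inv t \<otimes> g \<in> H"
    then show "t = rep (g <# H)"
      using g inv_mult_in_iff_l_coset_eq[OF assms] by (auto simp: T_def)
  qed
  then show ?thesis by (intro exI[of _ T]) (auto simp: T_def)
qed

end

text \<open>Values are taken in the field rather than in its unit group; \<open>char_one\<close> and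
  multiplicativity already make them invertible, see \<open>char_inv\<close>.\<close>

locale linear_character = group G + subgroup H G for G (structure) and H +
  fixes \<chi> :: "'a \<Rightarrow> 'k :: field"
  assumes char_one: "\<chi> \<one> = 1"
    and char_mult: "\<And>x y. x \<in> H \<Longrightarrow> y \<in> H \<Longrightarrow> \<chi> (x \<otimes> y) = \<chi> x * \<chi> y"
begin

lemma in_mult_right_iff:
  assumes "g \<in> carrier G" "h \<in> H"
  shows "g \<otimes> h \<in> H \<longleftrightarrow> g \<in> H"
proof
  assume "g \<otimes> h \<in> H"
  then have "g \<otimes> h \<otimes> inv h \<in> H" using assms m_inv_closed by blast
  then show "g \<in> H" using assms by (simp add: m_assoc)
qed (use assms in blast)

lemma in_mult_left_iff:
  assumes "g \<in> carrier G" "h \<in> H"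
  shows "h \<otimes> g \<in> H \<longleftrightarrow> g \<in> H"
proof
  assume "h \<otimes> g \<in> H"
  then have "inv h \<otimes> (h \<otimes> g) \<in> H" using assms m_inv_closed by blast
  then show "g \<in> H" using assms by (simp add: m_assoc[symmetric])
qed (use assms in blast)

lemma extend_zero_mult_right:
  assumes "g \<in> carrier G" "h \<in> H"
  shows "extend_zero H \<chi> (g \<otimes> h) = extend_zero H \<chi> g * \<chi> h"
  using assms by (simp add: extend_zero_def in_mult_right_iff char_mult)

lemma extend_zero_mult_left:
  assumes "g \<in> carrier G" "h \<in> H"
  shows "extend_zero H \<chi> (h \<otimes> g) = \<chi> h * extend_zero H \<chi> g"
  using assms by (simp add: extend_zero_def in_mult_left_iff char_mult)

lemma char_inv:
  assumes "h \<in> H"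
  shows "\<chi> (inv h) * \<chi> h = 1"
  using char_mult[of "inv h" h] assms by (simp add: char_one)

text \<open>Hence the summand of the Frobenius formula at s depends only on the left coset of
  s.\<close>

lemma extend_zero_conjugate:
  assumes "g \<in> carrier G" "h \<in> H"
  shows "extend_zero H \<chi> (inv h \<otimes> g \<otimes> h) = extend_zero H \<chi> g"
  using assms char_inv[of h]
  by (simp add: extend_zero_mult_right extend_zero_mult_left mult.commute[of "extend_zero H \<chi> g"] mult.left_commute)

text \<open>Multiplicativity of the induced representation, whose matrix entry at (x, y) is
  \<open>extend_zero H \<chi> (inv x \<otimes> \<sigma> \<otimes> y)\<close>. Only the y
  representing the coset of \<tau> \<otimes> z contributes; there the second factor is a genuine
  value of \<chi> and can be absorbed into the first.\<close>

lemma sum_transversal: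
  assumes T: "T \<subseteq> carrier G" "\<forall>g\<in>carrier G. \<exists>!t. t \<in> T \<and> inv t \<otimes> g \<in> H"
    and fin: "finite (carrier G)"
    and carrier: "\<sigma> \<in> carrier G" "\<tau> \<in> carrier G" "x \<in> carrier G" "z \<in> carrier G"
  shows "(\<Sum>y\<in>T. extend_zero H \<chi> (inv x \<otimes> \<sigma> \<otimes> y) * extend_zero H \<chi> (inv y \<otimes> \<tau> \<otimes> z)) =
    extend_zero H \<chi> (inv x \<otimes> (\<sigma> \<otimes> \<tau>) \<otimes> z)"
proof -
  let ?f = "\<lambda>y. extend_zero H \<chi> (inv x \<otimes> \<sigma> \<otimes> y) * extend_zero H \<chi> (inv y \<otimes> \<tau> \<otimes> z)"
  obtain t where t: "t \<in> T" "inv t \<otimes> (\<tau> \<otimes> z) \<in> H"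
    and uniq: "\<And>y. y \<in> T \<Longrightarrow> inv y \<otimes> (\<tau> \<otimes> z) \<in> H \<Longrightarrow> y = t"
  proof -
    have "\<tau> \<otimes> z \<in> carrier G" using carrier by simp
    then have "\<exists>!t. t \<in> T \<and> inv t \<otimes> (\<tau> \<otimes> z) \<in> H" using T(2) by blast
    then show ?thesis using that by blast
  qed
  have tG: "t \<in> carrier G" using t T by blast
  have "sum ?f T = sum ?f {t}"
  proof (rule sum.mono_neutral_right)
    show "finite T" using T fin finite_subset by blast
    show "\<forall>y\<in>T - {t}. ?f y = 0"
    proof
      fix y assume y: "y \<in> T - {t}"
      then have "inv y \<otimes> (\<tau> \<otimes> z) \<notin> H" using uniq by blast
      moreover have "y \<in> carrier G" using y T by blast
      ultimately show "?f y = 0" using carrier by (simp add: extend_zero_def m_assoc)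
    qed
  qed (use t in auto)
  also have "\<dots> = extend_zero H \<chi> (inv x \<otimes> \<sigma> \<otimes> t) * \<chi> (inv t \<otimes> (\<tau> \<otimes> z))"
    using t tG carrier by (simp add: m_assoc) (simp add: extend_zero_def)
  also have "\<dots> = extend_zero H \<chi> (inv x \<otimes> \<sigma> \<otimes> t \<otimes> (inv t \<otimes> (\<tau> \<otimes> z)))"
    using t tG carrier by (intro extend_zero_mult_right[symmetric]) auto
  also have "inv x \<otimes> \<sigma> \<otimes> t \<otimes> (inv t \<otimes> (\<tau> \<otimes> z)) = inv x \<otimes> (\<sigma> \<otimes> \<tau>) \<otimes> z"
  proof -
    have "t \<otimes> (inv t \<otimes> (\<tau> \<otimes> z)) = \<tau> \<otimes> z" using tG carrier by (simp add: m_assoc[symmetric])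
    then show ?thesis using tG carrier by (simp add: m_assoc)
  qed
  finally show ?thesis .
qed

text \<open>Every s is uniquely a product of some t in T and some h in H, and by
  \<open>extend_zero_conjugate\<close> the factor h does not affect the summand.\<close>

lemma sum_conjugates_transversal:
  assumes T: "T \<subseteq> carrier G" "\<forall>g\<in>carrier G. \<exists>!t. t \<in> T \<and> inv t \<otimes> g \<in> H"
    and "\<sigma> \<in> carrier G"
  shows "(\<Sum>s\<in>carrier G. extend_zero H \<chi> (inv s \<otimes> \<sigma> \<otimes> s)) =
    of_nat (card H) * (\<Sum>t\<in>T. extend_zero H \<chi> (inv t \<otimes> \<sigma> \<otimes> t))"
proof -
  have "(\<Sum>s\<in>carrier G. extend_zero H \<chi> (inv s \<otimes> \<sigma> \<otimes> s)) =
      (\<Sum>p\<in>T \<times> H. extend_zero H \<chi> (inv (fst p) \<otimes> \<sigma> \<otimes> fst p))"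
  proof (rule sum.reindex_bij_witness[symmetric])
    fix p assume p: "p \<in> T \<times> H"
    then have pG: "fst p \<in> carrier G" "snd p \<in> carrier G" using T by auto
    have "inv (fst p) \<otimes> (fst p \<otimes> snd p) = snd p" using pG by (simp add: m_assoc[symmetric])
    then have "(THE t. t \<in> T \<and> inv t \<otimes> (fst p \<otimes> snd p) \<in> H) = fst p"
      using T(2) p pG by (intro the1_equality) auto
    then show "(\<lambda>s. let t = THE t. t \<in> T \<and> inv t \<otimes> s \<in> H in (t, inv t \<otimes> s)) (fst p \<otimes> snd p) = p"
      using pG by (simp add: m_assoc[symmetric] prod_eq_iff)
    show "fst p \<otimes> snd p \<in> carrier G" using pG by simp
    have "inv (fst p \<otimes> snd p) \<otimes> \<sigma> \<otimes> (fst p \<otimes> snd p) =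
        inv (snd p) \<otimes> (inv (fst p) \<otimes> \<sigma> \<otimes> fst p) \<otimes> snd p"
      using pG assms(3) by (simp add: inv_mult_group m_assoc)
    then show "extend_zero H \<chi> (inv (fst p \<otimes> snd p) \<otimes> \<sigma> \<otimes> (fst p \<otimes> snd p)) =
        extend_zero H \<chi> (inv (fst p) \<otimes> \<sigma> \<otimes> fst p)"
      using extend_zero_conjugate[of "inv (fst p) \<otimes> \<sigma> \<otimes> fst p" "snd p"] pG p assms(3) by auto
  next
    fix s assume s: "s \<in> carrier G"
    define t where "t = (THE t. t \<in> T \<and> inv t \<otimes> s \<in> H)"
    have t: "t \<in> T" "inv t \<otimes> s \<in> H" using theI'[of "\<lambda>t. t \<in> T \<and> inv t \<otimes> s \<in> H"] T(2) s by (auto simp: t_def)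
    show "(let t = THE t. t \<in> T \<and> inv t \<otimes> s \<in> H in (t, inv t \<otimes> s)) \<in> T \<times> H"
      using t by (simp add: t_def[symmetric])
    have "t \<in> carrier G" using t T by blast
    then show "fst (let t = THE t. t \<in> T \<and> inv t \<otimes> s \<in> H in (t, inv t \<otimes> s)) \<otimes>
        snd (let t = THE t. t \<in> T \<and> inv t \<otimes> s \<in> H in (t, inv t \<otimes> s)) = s"
      using s by (simp add: t_def[symmetric] m_assoc[symmetric])
  qed
  also have "\<dots> = of_nat (card H) * (\<Sum>t\<in>T. extend_zero H \<chi> (inv t \<otimes> \<sigma> \<otimes> t))"
    by (simp add: sum.cartesian_product[of "\<lambda>t _. extend_zero H \<chi> (inv t \<otimes> \<sigma> \<otimes> t)" H T, unfolded case_prod_unfold, symmetric]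
        sum_distrib_left)
  finally show ?thesis .
qed

end

text \<open>The Frobenius formula in its averaged form over the whole group, which involves no
  choice of a transversal.\<close>

definition induced_char :: "nat \<Rightarrow> (nat \<Rightarrow> nat) set \<Rightarrow> ((nat \<Rightarrow> nat) \<Rightarrow> 'k) \<Rightarrow> (nat \<Rightarrow> nat) \<Rightarrow> 'k :: field" where
  "induced_char d W \<chi> = (\<lambda>\<sigma>\<in>carrier (sym_group d). 1 / of_nat (card W) *
    (\<Sum>s\<in>carrier (sym_group d). extend_zero W \<chi> (inv\<^bsub>sym_group d\<^esub> s \<circ> \<sigma> \<circ> s)))"

lemma finite_carrier_sym_group: "finite (carrier (sym_group d))"
  by (simp add: sym_group_def finite_permutations)

text \<open>It is the trace of the monomial representation indexed by a left transversal of W; the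
  averaged sum is |W| times that trace, and |W| is cancelled in characteristic zero.\<close>

lemma induced_char_in_sym_characters:
  fixes \<chi> :: "_ \<Rightarrow> 'k :: field_char_0"
  assumes "linear_character (sym_group d) W \<chi>"
  shows "induced_char d W \<chi> \<in> sym_characters d"
proof -
  interpret linear_character "sym_group d" W \<chi> by (rule assms)
  obtain T where T: "T \<subseteq> carrier (sym_group d)"
    "\<forall>g\<in>carrier (sym_group d). \<exists>!t. t \<in> T \<and> inv\<^bsub>sym_group d\<^esub> t \<otimes>\<^bsub>sym_group d\<^esub> g \<in> W"
    using ex_transversal[OF subgroup_axioms] by blast
  define R where "R \<sigma> x y = extend_zero W \<chi> (inv\<^bsub>sym_group d\<^esub> x \<otimes>\<^bsub>sym_group d\<^esub> \<sigma> \<otimes>\<^bsub>sym_group d\<^esub> y)" for \<sigma> x y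
  have "index_rep d T R"
    unfolding index_rep_def
  proof (intro conjI ballI)
    show "finite T" using T(1) finite_carrier_sym_group finite_subset by blast
  next
    fix x y assume xy: "x \<in> T" "y \<in> T"
    then have xyG: "x \<in> carrier (sym_group d)" "y \<in> carrier (sym_group d)" using T(1) by auto
    have "inv\<^bsub>sym_group d\<^esub> x \<otimes>\<^bsub>sym_group d\<^esub> y \<in> W \<longleftrightarrow> x = y"
    proof -
      have "inv\<^bsub>sym_group d\<^esub> y \<otimes>\<^bsub>sym_group d\<^esub> y \<in> W" using xyG(2) one_closed by (simp only: l_inv)
      moreover have "\<exists>!t. t \<in> T \<and> inv\<^bsub>sym_group d\<^esub> t \<otimes>\<^bsub>sym_group d\<^esub> y \<in> W" using T(2) xyG(2) by blast
      ultimately show ?thesis using xy by blast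
    qed
    moreover have "R \<one>\<^bsub>sym_group d\<^esub> x y = extend_zero W \<chi> (inv\<^bsub>sym_group d\<^esub> x \<otimes>\<^bsub>sym_group d\<^esub> y)"
      using xyG by (simp add: R_def del: sym_group_inv_equality)
    ultimately show "R id x y = (if x = y then 1 else 0)"
      using xyG(2) char_one
      by (auto simp: extend_zero_def sym_group_one simp del: sym_group_inv_equality)
  next
    fix \<sigma> \<tau> x z
    assume "\<sigma> \<in> carrier (sym_group d)" "\<tau> \<in> carrier (sym_group d)" "x \<in> T" "z \<in> T"
    then have "R (\<sigma> \<otimes>\<^bsub>sym_group d\<^esub> \<tau>) x z = (\<Sum>y\<in>T. R \<sigma> x y * R \<tau> y z)"
      unfolding R_def using T(1)
      by (intro sum_transversal[OF T finite_carrier_sym_group, symmetric]) auto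
    then show "R (\<sigma> \<circ> \<tau>) x z = (\<Sum>y\<in>T. R \<sigma> x y * R \<tau> y z)" by (simp add: sym_group_mult)
  qed
  then have "(\<lambda>\<sigma>\<in>carrier (sym_group d). \<Sum>t\<in>T. R \<sigma> t t) \<in> sym_characters d"
    by (rule index_rep_imp_sym_character)
  also have "(\<lambda>\<sigma>\<in>carrier (sym_group d). \<Sum>t\<in>T. R \<sigma> t t) = induced_char d W \<chi>"
    unfolding induced_char_def
  proof (rule restrict_ext)
    fix \<sigma> assume "\<sigma> \<in> carrier (sym_group d)"
    from sum_conjugates_transversal[OF T this]
    have "(\<Sum>s\<in>carrier (sym_group d). extend_zero W \<chi> (inv\<^bsub>sym_group d\<^esub> s \<circ> \<sigma> \<circ> s)) =
        of_nat (card W) * (\<Sum>t\<in>T. R \<sigma> t t)"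
      unfolding R_def sym_group_mult .
    moreover have "card W \<noteq> 0"
    proof -
      have "finite W" using finite_subset[OF subset finite_carrier_sym_group] .
      moreover have "W \<noteq> {}" using subgroup.one_closed[OF subgroup_axioms] by blast
      ultimately show ?thesis by simp
    qed
    ultimately show "(\<Sum>t\<in>T. R \<sigma> t t) = 1 / of_nat (card W) *
        (\<Sum>s\<in>carrier (sym_group d). extend_zero W \<chi> (inv\<^bsub>sym_group d\<^esub> s \<circ> \<sigma> \<circ> s))"
      by simp
  qed
  finally show ?thesis .
qed

section \<open>The characteristic map\<close>

definition cycle_type :: "nat \<Rightarrow> (nat \<Rightarrow> nat) \<Rightarrow> nat \<Rightarrow>\<^sub>0 nat" where
  "cycle_type d \<sigma> = (\<Sum>s = 1..d. Poly_Mapping.single s (num_cycles d s \<sigma>))"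

lemma lookup_cycle_type:
  "Poly_Mapping.lookup (cycle_type d \<sigma>) s = (if s \<in> {1..d} then num_cycles d s \<sigma> else 0)"
proof -
  have "Poly_Mapping.lookup (cycle_type d \<sigma>) s = (\<Sum>t = 1..d. if t = s then num_cycles d t \<sigma> else 0)"
    unfolding cycle_type_def lookup_sum by (simp add: lookup_single when_def)
  then show ?thesis by (simp add: sum.delta)
qed

lemma keys_cycle_type: "Poly_Mapping.keys (cycle_type d \<sigma>) \<subseteq> {1..d}"
  by (auto simp: in_keys_iff lookup_cycle_type split: if_splits)

text \<open>A polynomial whose value at the power sums is \<open>ch d u\<close>; permutations of
  equal cycle type are collected in one coefficient.\<close>

definition ch_poly :: "nat \<Rightarrow> ((nat \<Rightarrow> nat) \<Rightarrow> 'k :: field_char_0) \<Rightarrow> (nat \<Rightarrow>\<^sub>0 nat) \<Rightarrow>\<^sub>0 'k" where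
  "ch_poly d u = (\<Sum>\<sigma>\<in>carrier (sym_group d). Poly_Mapping.single (cycle_type d \<sigma>) (u \<sigma> / fact d))"

lemma eval_psum_sum: "eval_psum d (sum f S) = (\<Sum>x\<in>S. eval_psum d (f x))"
proof (induction S rule: infinite_finite_induct)
  case (insert x S)
  then show ?case by (simp add: eval_psum_add)
qed (simp_all add: eval_psum_def)

lemma mscale_sum: "mscale c (sum f S) = (\<Sum>x\<in>S. mscale c (f x))"
  by (rule mfps_eqI) (simp add: mscale.rep_eq mcoeff_sum sum_distrib_left)

lemma mscale_mscale: "mscale a (mscale b F) = mscale (a * b) F"
  by (rule mfps_eqI) (simp add: mscale.rep_eq mult.assoc)

lemma eval_ch_poly: "eval_psum d (ch_poly d u) = ch d u"
  by (simp add: ch_poly_def ch_def eval_psum_sum eval_psum_single cycle_psum_def mscale_sum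
      mscale_mscale lookup_cycle_type)

lemma lookup_ch_poly:
  "Poly_Mapping.lookup (ch_poly d u) m =
    (\<Sum>\<sigma>\<in>carrier (sym_group d). if cycle_type d \<sigma> = m then u \<sigma> / fact d else 0)"
  by (simp add: ch_poly_def lookup_sum lookup_single when_def)

lemma keys_ch_poly: "Poly_Mapping.keys (ch_poly d u) \<subseteq> cycle_type d ` carrier (sym_group d)"
proof
  fix m assume "m \<in> Poly_Mapping.keys (ch_poly d u)"
  then have "(\<Sum>\<sigma>\<in>carrier (sym_group d). if cycle_type d \<sigma> = m then u \<sigma> / fact d else 0) \<noteq> 0"
    unfolding in_keys_iff lookup_ch_poly .
  then obtain \<sigma> where "\<sigma> \<in> carrier (sym_group d)" "(if cycle_type d \<sigma> = m then u \<sigma> / fact d else 0) \<noteq> 0"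
    by (rule sum.not_neutral_contains_not_neutral)
  then show "m \<in> cycle_type d ` carrier (sym_group d)" by (auto split: if_splits)
qed

lemma keys_ch_poly_subset: "\<forall>m\<in>Poly_Mapping.keys (ch_poly d u). Poly_Mapping.keys m \<subseteq> {1..d}"
  using keys_ch_poly keys_cycle_type by blast

text \<open>Each permutation adds its value divided by d! to exactly one coefficient, so the sum of
  all coefficients is the average.\<close>

lemma coeff_sum_ch:
  "coeff_sum d (ch d u) = (\<Sum>\<sigma>\<in>carrier (sym_group d). u \<sigma>) / fact d"
proof -
  let ?S = "cycle_type d ` carrier (sym_group d)"
  have "coeff_sum d (ch d u) = (\<Sum>m\<in>Poly_Mapping.keys (ch_poly d u). Poly_Mapping.lookup (ch_poly d u) m)"
    using coeff_sum_eval_psum[OF keys_ch_poly_subset] by (simp add: eval_ch_poly)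
  also have "\<dots> = (\<Sum>m\<in>?S. Poly_Mapping.lookup (ch_poly d u) m)"
    using keys_ch_poly finite_carrier_sym_group
    by (intro sum.mono_neutral_left) (auto simp: in_keys_iff)
  also have "\<dots> = (\<Sum>\<sigma>\<in>carrier (sym_group d). \<Sum>m\<in>?S. if cycle_type d \<sigma> = m then u \<sigma> / fact d else 0)"
    unfolding lookup_ch_poly by (rule sum.swap)
  also have "\<dots> = (\<Sum>\<sigma>\<in>carrier (sym_group d). u \<sigma> / fact d)"
    using finite_carrier_sym_group by (intro sum.cong) auto
  finally show ?thesis by (simp add: sum_divide_distrib)
qed

lemma gen_characters_cycle_type:
  assumes "u \<in> gen_characters d" "\<sigma> \<in> carrier (sym_group d)" "\<tau> \<in> carrier (sym_group d)"
    and "cycle_type d \<sigma> = cycle_type d \<tau>"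
  shows "u \<sigma> = u \<tau>"
proof -
  have "num_cycles d s \<sigma> = num_cycles d s \<tau>" if "s \<in> {1..d}" for s
    using arg_cong[OF assms(4), of "\<lambda>m. Poly_Mapping.lookup m s"] that by (simp add: lookup_cycle_type)
  then obtain \<zeta> where "\<zeta> permutes {1..d}" "\<zeta> \<circ> \<sigma> = \<tau> \<circ> \<zeta>"
    using conjugate_if_num_cycles_eq assms(2,3) unfolding sym_group_carrier by blast
  then show ?thesis using assms(1-3) gen_characters_conjugate unfolding sym_group_carrier[symmetric] by blast
qed

text \<open>A generalized character is constant on each cycle type, so the coefficient there is its
  value times the number of such permutations, divided by d!. That number is nonzero in the field.
  Outside S_d both functions are \<open>undefined\<close>.\<close>

lemma inj_on_ch: "inj_on (ch d :: _ \<Rightarrow> 'k :: field_char_0 mfps) (gen_characters d)"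
proof (rule inj_onI)
  fix u v :: "(nat \<Rightarrow> nat) \<Rightarrow> 'k"
  assume u: "u \<in> gen_characters d" and v: "v \<in> gen_characters d" and eq: "ch d u = ch d v"
  have poly: "ch_poly d u = ch_poly d v"
    using eq by (intro eval_psum_inject[OF keys_ch_poly_subset keys_ch_poly_subset]) (simp add: eval_ch_poly)
  have lookup: "Poly_Mapping.lookup (ch_poly d w) (cycle_type d \<sigma>) =
      of_nat (card {\<tau> \<in> carrier (sym_group d). cycle_type d \<tau> = cycle_type d \<sigma>}) * (w \<sigma> / fact d)"
    if "w \<in> gen_characters d" "\<sigma> \<in> carrier (sym_group d)" for w :: "_ \<Rightarrow> 'k" and \<sigma>
  proof -
    have "Poly_Mapping.lookup (ch_poly d w) (cycle_type d \<sigma>) =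
        (\<Sum>\<tau>\<in>carrier (sym_group d). if cycle_type d \<tau> = cycle_type d \<sigma> then w \<sigma> / fact d else 0)"
      unfolding lookup_ch_poly
    proof (rule sum.cong)
      fix \<tau> assume "\<tau> \<in> carrier (sym_group d)"
      then show "(if cycle_type d \<tau> = cycle_type d \<sigma> then w \<tau> / fact d else 0) =
          (if cycle_type d \<tau> = cycle_type d \<sigma> then w \<sigma> / fact d else 0)"
        using gen_characters_cycle_type[OF that(1) _ that(2), of \<tau>] by presburger
    qed simp
    then show ?thesis
      by (simp add: sum.inter_filter[symmetric] finite_carrier_sym_group)
  qed
  have "u \<sigma> = v \<sigma>" if "\<sigma> \<in> carrier (sym_group d)" for \<sigma>
  proof -
    have "card {\<tau> \<in> carrier (sym_group d). cycle_type d \<tau> = cycle_type d \<sigma>} \<noteq> 0"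
      using that finite_carrier_sym_group by auto
    moreover have "Poly_Mapping.lookup (ch_poly d u) (cycle_type d \<sigma>) = Poly_Mapping.lookup (ch_poly d v) (cycle_type d \<sigma>)"
      by (simp only: poly)
    ultimately show ?thesis unfolding lookup[OF u that] lookup[OF v that] by simp
  qed
  moreover have "u \<in> extensional (carrier (sym_group d))" "v \<in> extensional (carrier (sym_group d))"
    using u v by (auto simp: gen_characters_def)
  ultimately show "u = v" by (metis extensionalityI)
qed

section \<open>The internal product and the cycle index as images under \<open>ch\<close>\<close>

lemma internal_prod_ch:
  assumes "u \<in> gen_characters d" "v \<in> gen_characters d"
  shows "internal_prod d (ch d u) (ch d v) = ch d (\<lambda>\<sigma>\<in>carrier (sym_group d). u \<sigma> * v \<sigma>)"
  using assms by (simp add: internal_prod_def inv_into_f_f[OF inj_on_ch])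

text \<open>Stated for genuine characters because \<open>sym_characters_mult\<close> keeps the
  accumulator among them, hence where the internal product is specified.\<close>

lemma foldl_internal_prod_ch:
  assumes "u \<in> sym_characters d" "\<And>m. m \<in> set ms \<Longrightarrow> v m \<in> sym_characters d"
  shows "foldl (internal_prod d) (ch d u) (map (\<lambda>m. ch d (v m)) ms) =
    ch d (\<lambda>\<sigma>\<in>carrier (sym_group d). u \<sigma> * (\<Prod>m\<leftarrow>ms. v m \<sigma>))"
  using assms
proof (induction ms arbitrary: u)
  case Nil
  then have "u = restrict u (carrier (sym_group d))" by (auto simp: sym_characters_def)
  then show ?case by simp
next
  case (Cons m ms)
  have "foldl (internal_prod d) (ch d u) (map (\<lambda>m. ch d (v m)) (m # ms)) =
      foldl (internal_prod d) (ch d (\<lambda>\<sigma>\<in>carrier (sym_group d). u \<sigma> * v m \<sigma>)) (map (\<lambda>m. ch d (v m)) ms)"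
    using Cons.prems sym_characters_subset_gen_characters by (subst internal_prod_ch[symmetric]) auto
  also have "\<dots> = ch d (\<lambda>\<sigma>\<in>carrier (sym_group d).
      (\<lambda>\<sigma>\<in>carrier (sym_group d). u \<sigma> * v m \<sigma>) \<sigma> * (\<Prod>m\<leftarrow>ms. v m \<sigma>))"
    using Cons.prems by (intro Cons.IH sym_characters_mult) auto
  also have "\<dots> = ch d (\<lambda>\<sigma>\<in>carrier (sym_group d). u \<sigma> * (\<Prod>m\<leftarrow>m # ms. v m \<sigma>))"
    by (intro arg_cong[of _ _ "ch d"] restrict_ext) (simp add: mult.assoc)
  finally show ?case .
qed

lemma cycle_psum_conjugate:
  assumes "\<sigma> \<in> carrier (sym_group d)" "s \<in> carrier (sym_group d)"
  shows "cycle_psum d (inv\<^bsub>sym_group d\<^esub> s \<circ> \<sigma> \<circ> s) = cycle_psum d \<sigma>"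
proof -
  have s: "s permutes {1..d}" and \<sigma>: "\<sigma> permutes {1..d}" using assms by (auto simp: sym_group_carrier)
  have "s \<circ> (inv' s \<circ> \<sigma> \<circ> s) = \<sigma> \<circ> s" using permutes_inv_o(1)[OF s] by (simp add: comp_assoc[symmetric])
  moreover have "inv' s \<circ> \<sigma> \<circ> s permutes {1..d}"
    using s \<sigma> by (intro permutes_compose permutes_inv)
  ultimately have "num_cycles d n \<sigma> = num_cycles d n (inv' s \<circ> \<sigma> \<circ> s)" for n
    using s by (intro num_cycles_conjugate) auto
  then show ?thesis using assms(2) by (simp add: cycle_psum_def)
qed

text \<open>After swapping the sums, the terms for a fixed s can be conjugated back to s = 1, since
  \<open>cycle_psum\<close> is a class function. This gives d! equal copies of the sum over W, which
  cancel the 1/d! in \<open>ch\<close>.\<close>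

lemma ch_induced_char:
  fixes \<chi> :: "_ \<Rightarrow> 'k :: field_char_0"
  assumes "subgroup W (sym_group d)"
  shows "ch d (induced_char d W \<chi>) = cycle_index d W \<chi>"
proof -
  interpret G: group "sym_group d" by (rule sym_group_is_group)
  let ?G = "carrier (sym_group d)"
  have WG: "W \<subseteq> ?G" using assms by (rule subgroup.subset)
  let ?c = "\<lambda>s \<sigma>. inv\<^bsub>sym_group d\<^esub> s \<circ> \<sigma> \<circ> s"
  have conj: "(\<Sum>\<sigma>\<in>?G. mscale (extend_zero W \<chi> (?c s \<sigma>)) (cycle_psum d \<sigma>)) =
      (\<Sum>\<sigma>\<in>W. mscale (\<chi> \<sigma>) (cycle_psum d \<sigma>))" if s: "s \<in> ?G" for s
  proof -
    have "(\<Sum>\<sigma>\<in>?G. mscale (extend_zero W \<chi> (?c s \<sigma>)) (cycle_psum d \<sigma>)) =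
        (\<Sum>\<sigma>\<in>?G. mscale (extend_zero W \<chi> (?c s \<sigma>)) (cycle_psum d (?c s \<sigma>)))"
      using s by (intro sum.cong refl) (simp add: cycle_psum_conjugate del: sym_group_inv_equality)
    also have "\<dots> = (\<Sum>\<sigma>\<in>?G. mscale (extend_zero W \<chi> \<sigma>) (cycle_psum d \<sigma>))"
    proof (rule sum.reindex_bij_witness[of _ "\<lambda>\<tau>. s \<circ> \<tau> \<circ> inv\<^bsub>sym_group d\<^esub> s" "?c s"])
      have s': "inv\<^bsub>sym_group d\<^esub> s \<in> ?G" using s by (rule G.inv_closed)
      have "s \<circ> inv\<^bsub>sym_group d\<^esub> s = id" "inv\<^bsub>sym_group d\<^esub> s \<circ> s = id"
        using s G.r_inv[OF s] G.l_inv[OF s] unfolding sym_group_mult sym_group_one by simp_all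
      then have s_id: "s \<circ> (inv\<^bsub>sym_group d\<^esub> s \<circ> \<tau>) = \<tau>" "inv\<^bsub>sym_group d\<^esub> s \<circ> (s \<circ> \<tau>) = \<tau>"
        "\<tau> \<circ> s \<circ> inv\<^bsub>sym_group d\<^esub> s = \<tau>" "\<tau> \<circ> inv\<^bsub>sym_group d\<^esub> s \<circ> s = \<tau>" for \<tau> :: "nat \<Rightarrow> nat"
        by (simp_all only: comp_assoc[symmetric]) (simp_all only: comp_assoc id_comp comp_id)
      fix \<sigma> assume \<sigma>: "\<sigma> \<in> ?G"
      show "s \<circ> ?c s \<sigma> \<circ> inv\<^bsub>sym_group d\<^esub> s = \<sigma>" "?c s (s \<circ> \<sigma> \<circ> inv\<^bsub>sym_group d\<^esub> s) = \<sigma>"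
        using s_id by (simp_all only: comp_assoc)
      show "?c s \<sigma> \<in> ?G" "s \<circ> \<sigma> \<circ> inv\<^bsub>sym_group d\<^esub> s \<in> ?G"
        using s s' \<sigma> unfolding sym_group_mult[of d, symmetric] by (simp_all only: G.m_closed)
    qed simp
    also have "\<dots> = (\<Sum>\<sigma>\<in>W. mscale (\<chi> \<sigma>) (cycle_psum d \<sigma>))"
      using WG by (intro sum.mono_neutral_cong_right)
        (auto simp: finite_carrier_sym_group extend_zero_def mscale_def zero_mfps_def)
    finally show ?thesis .
  qed
  have scale: "mscale (sum f S) F = (\<Sum>x\<in>S. mscale (f x) F)" for f :: "_ \<Rightarrow> 'k" and S :: "(nat \<Rightarrow> nat) set" and F
    by (rule mfps_eqI) (simp add: mscale.rep_eq mcoeff_sum sum_distrib_right)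
  have "mscale (induced_char d W \<chi> \<sigma>) (cycle_psum d \<sigma>) = mscale (1 / of_nat (card W))
      (\<Sum>s\<in>?G. mscale (extend_zero W \<chi> (?c s \<sigma>)) (cycle_psum d \<sigma>))" if "\<sigma> \<in> ?G" for \<sigma>
    by (simp only: induced_char_def restrict_apply'[OF that] mscale_mscale[symmetric] scale)
  then have "ch d (induced_char d W \<chi>) = mscale (1 / fact d) (mscale (1 / of_nat (card W))
      (\<Sum>\<sigma>\<in>?G. \<Sum>s\<in>?G. mscale (extend_zero W \<chi> (?c s \<sigma>)) (cycle_psum d \<sigma>)))"
    unfolding ch_def by (simp only: mscale_sum[of "1 / of_nat (card W)"] cong: sum.cong)
  also have "\<dots> = mscale (1 / fact d) (mscale (1 / of_nat (card W))
      (\<Sum>s\<in>?G. \<Sum>\<sigma>\<in>W. mscale (\<chi> \<sigma>) (cycle_psum d \<sigma>)))"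
    by (subst sum.swap) (simp add: conj del: sym_group_inv_equality)
  also have "\<dots> = mscale (1 / fact d) (mscale (1 / of_nat (card W))
      (mscale (fact d) (\<Sum>\<sigma>\<in>W. mscale (\<chi> \<sigma>) (cycle_psum d \<sigma>))))"
  proof -
    have "card ?G = fact d" using card_permutations[of "{1..d}" d] by (simp add: sym_group_def)
    moreover have "of_nat n * F = mscale (of_nat n) F" for n and F :: "'k mfps"
    proof (induction n)
      case (Suc n)
      then show ?case
        by (intro mfps_eqI) (simp add: distrib_right mscale.rep_eq plus_mfps.rep_eq)
    qed (auto intro!: mfps_eqI simp: mscale.rep_eq zero_mfps.rep_eq)
    ultimately show ?thesis by simp
  qed
  also have "\<dots> = cycle_index d W \<chi>" by (simp add: cycle_index_def mscale_mscale mult.commute)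
  finally show ?thesis .
qed

section \<open>Counting superpositions\<close>

context group
begin

lemma r_mult_cancel_inv: "x \<in> carrier G \<Longrightarrow> y \<in> carrier G \<Longrightarrow> x \<otimes> (inv x \<otimes> y) = y"
  by (simp add: m_assoc[symmetric])

lemma l_mult_cancel_inv: "x \<in> carrier G \<Longrightarrow> y \<in> carrier G \<Longrightarrow> inv x \<otimes> (x \<otimes> y) = y"
  by (simp add: m_assoc[symmetric])

end

text \<open>An abstract finite group replaces S_d, so that the counting uses group laws instead of
  composition of functions.\<close>

locale superposition = group G for G (structure) +
  fixes I :: "'i set" and H :: "'i \<Rightarrow> 'a set"
  assumes fin_carrier: "finite (carrier G)" and fin_I: "finite I"
    and subgroups: "\<And>m. m \<in> I \<Longrightarrow> subgroup (H m) G"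
begin

definition tuples :: "('i \<Rightarrow> 'a) set" where
  "tuples = I \<rightarrow>\<^sub>E carrier G"

definition rel :: "(('i \<Rightarrow> 'a) \<times> ('i \<Rightarrow> 'a)) set" where
  "rel = {(x, y). x \<in> tuples \<and> y \<in> tuples \<and>
    (\<exists>\<zeta>\<in>carrier G. \<exists>w. \<forall>m\<in>I. w m \<in> H m \<and> y m = \<zeta> \<otimes> x m \<otimes> w m)}"

text \<open>The intersection of the conjugates of the subgroups, phrased by pulling g back into each
  \<open>H m\<close>, where the characters are defined.\<close>

definition aut :: "('i \<Rightarrow> 'a) \<Rightarrow> 'a set" where
  "aut x = {g \<in> carrier G. \<forall>m\<in>I. inv (x m) \<otimes> g \<otimes> x m \<in> H m}"

lemma H_carrier: "m \<in> I \<Longrightarrow> h \<in> H m \<Longrightarrow> h \<in> carrier G"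
  using subgroups subgroup.mem_carrier by metis

lemma tuples_carrier: "x \<in> tuples \<Longrightarrow> m \<in> I \<Longrightarrow> x m \<in> carrier G"
  by (auto simp: tuples_def)

lemma finite_tuples: "finite tuples"
  by (simp add: tuples_def finite_PiE fin_I fin_carrier)

lemma equiv_rel: "equiv tuples rel"
proof (rule equivI)
  show "rel \<subseteq> tuples \<times> tuples" by (auto simp: rel_def)
  show "refl_on tuples rel"
  proof (rule refl_onI)
    fix x assume x: "x \<in> tuples"
    have "\<forall>m\<in>I. \<one> \<in> H m \<and> x m = \<one> \<otimes> x m \<otimes> \<one>"
      using tuples_carrier[OF x] subgroups by (auto intro: subgroup.one_closed)
    then have "\<exists>\<zeta>\<in>carrier G. \<exists>w. \<forall>m\<in>I. w m \<in> H m \<and> x m = \<zeta> \<otimes> x m \<otimes> w m"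
      by (intro bexI[of _ \<one>] exI[of _ "\<lambda>_. \<one>"]) auto
    with x show "(x, x) \<in> rel" by (simp add: rel_def)
  qed
  show "sym rel"
  proof (rule symI)
    fix x y assume "(x, y) \<in> rel"
    then obtain \<zeta> w where xy: "x \<in> tuples" "y \<in> tuples" and \<zeta>: "\<zeta> \<in> carrier G"
      and w: "\<And>m. m \<in> I \<Longrightarrow> w m \<in> H m" "\<And>m. m \<in> I \<Longrightarrow> y m = \<zeta> \<otimes> x m \<otimes> w m"
      by (auto simp: rel_def)
    have "inv (w m) \<in> H m \<and> x m = inv \<zeta> \<otimes> y m \<otimes> inv (w m)" if m: "m \<in> I" for m
      using tuples_carrier[OF xy(1) m] H_carrier[OF m w(1)[OF m]] \<zeta> w[OF m]
        subgroup.m_inv_closed[OF subgroups[OF m]]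
      by (simp add: m_assoc l_mult_cancel_inv)
    then have "\<exists>\<zeta>\<in>carrier G. \<exists>w. \<forall>m\<in>I. w m \<in> H m \<and> x m = \<zeta> \<otimes> y m \<otimes> w m"
      using \<zeta> by (intro bexI[of _ "inv \<zeta>"] exI[of _ "\<lambda>m. inv (w m)"]) auto
    then show "(y, x) \<in> rel" using xy by (simp add: rel_def)
  qed
  show "trans rel"
  proof (rule transI)
    fix x y z assume xy: "(x, y) \<in> rel" and yz: "(y, z) \<in> rel"
    obtain \<zeta> w where \<zeta>: "\<zeta> \<in> carrier G"
      and w: "\<And>m. m \<in> I \<Longrightarrow> w m \<in> H m" "\<And>m. m \<in> I \<Longrightarrow> y m = \<zeta> \<otimes> x m \<otimes> w m"
      using xy by (auto simp: rel_def)
    obtain \<xi> v where \<xi>: "\<xi> \<in> carrier G"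
      and v: "\<And>m. m \<in> I \<Longrightarrow> v m \<in> H m" "\<And>m. m \<in> I \<Longrightarrow> z m = \<xi> \<otimes> y m \<otimes> v m"
      using yz by (auto simp: rel_def)
    have xyz: "x \<in> tuples" "y \<in> tuples" "z \<in> tuples" using xy yz by (auto simp: rel_def)
    have "w m \<otimes> v m \<in> H m \<and> z m = \<xi> \<otimes> \<zeta> \<otimes> x m \<otimes> (w m \<otimes> v m)" if m: "m \<in> I" for m
      using tuples_carrier[OF xyz(1) m] H_carrier[OF m w(1)[OF m]] H_carrier[OF m v(1)[OF m]]
        \<zeta> \<xi> w[OF m] v[OF m] subgroup.m_closed[OF subgroups[OF m]]
      by (simp add: m_assoc)
    then have "\<exists>\<zeta>\<in>carrier G. \<exists>w. \<forall>m\<in>I. w m \<in> H m \<and> z m = \<zeta> \<otimes> x m \<otimes> w m"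
      using \<zeta> \<xi> by (intro bexI[of _ "\<xi> \<otimes> \<zeta>"] exI[of _ "\<lambda>m. w m \<otimes> v m"]) auto
    then show "(x, z) \<in> rel" using xyz by (simp add: rel_def)
  qed
qed

lemma subgroup_aut:
  assumes x: "x \<in> tuples"
  shows "subgroup (aut x) G"
proof (rule subgroupI)
  show "aut x \<subseteq> carrier G" by (auto simp: aut_def)
  have "\<one> \<in> aut x"
    using tuples_carrier[OF x] subgroups by (auto simp: aut_def intro: subgroup.one_closed)
  then show "aut x \<noteq> {}" by blast
next
  fix g assume g: "g \<in> aut x"
  then have gG: "g \<in> carrier G" by (simp add: aut_def)
  have "inv (x m) \<otimes> inv g \<otimes> x m \<in> H m" if m: "m \<in> I" for m
  proof -
    have "inv (inv (x m) \<otimes> g \<otimes> x m) \<in> H m"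
      by (rule subgroup.m_inv_closed[OF subgroups[OF m]]) (use g m in \<open>simp add: aut_def\<close>)
    then show ?thesis using tuples_carrier[OF x m] gG by (simp add: inv_mult_group m_assoc)
  qed
  then show "inv g \<in> aut x" using gG by (simp add: aut_def)
next
  fix g h assume g: "g \<in> aut x" and h: "h \<in> aut x"
  then have G: "g \<in> carrier G" "h \<in> carrier G" by (simp_all add: aut_def)
  have "inv (x m) \<otimes> (g \<otimes> h) \<otimes> x m \<in> H m" if m: "m \<in> I" for m
  proof -
    have "(inv (x m) \<otimes> g \<otimes> x m) \<otimes> (inv (x m) \<otimes> h \<otimes> x m) \<in> H m"
      by (rule subgroup.m_closed[OF subgroups[OF m]]) (use g h m in \<open>simp_all add: aut_def\<close>)
    then show ?thesis using tuples_carrier[OF x m] G by (simp add: m_assoc r_mult_cancel_inv)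
  qed
  then show "g \<otimes> h \<in> aut x" using G by (simp add: aut_def)
qed

text \<open>The orbit map at x for simultaneous left translation by \<zeta> and separate right
  translations by the w m.\<close>

definition act :: "('i \<Rightarrow> 'a) \<Rightarrow> 'a \<times> ('i \<Rightarrow> 'a) \<Rightarrow> 'i \<Rightarrow> 'a" where
  "act x p = (\<lambda>m\<in>I. fst p \<otimes> x m \<otimes> snd p m)"

lemma act_image:
  assumes x: "x \<in> tuples"
  shows "act x ` (carrier G \<times> Pi\<^sub>E I H) = rel `` {x}"
proof (intro equalityI subsetI)
  fix y assume "y \<in> act x ` (carrier G \<times> Pi\<^sub>E I H)"
  then obtain \<zeta> w where \<zeta>: "\<zeta> \<in> carrier G" and w: "w \<in> Pi\<^sub>E I H" and y: "y = act x (\<zeta>, w)" by blast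
  have "act x (\<zeta>, w) \<in> tuples"
    using \<zeta> w tuples_carrier[OF x] H_carrier by (auto simp: tuples_def act_def PiE_iff)
  moreover have "\<forall>m\<in>I. w m \<in> H m \<and> act x (\<zeta>, w) m = \<zeta> \<otimes> x m \<otimes> w m"
    using w by (auto simp: act_def)
  ultimately show "y \<in> rel `` {x}" using x \<zeta> y by (auto simp: rel_def)
next
  fix y assume "y \<in> rel `` {x}"
  then obtain \<zeta> w where y: "y \<in> tuples" and \<zeta>: "\<zeta> \<in> carrier G"
    and w: "\<forall>m\<in>I. w m \<in> H m \<and> y m = \<zeta> \<otimes> x m \<otimes> w m"
    by (auto simp: rel_def)
  have "y = act x (\<zeta>, restrict w I)"
    using y w by (auto simp: act_def tuples_def PiE_iff extensional_def fun_eq_iff)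
  moreover have "restrict w I \<in> Pi\<^sub>E I H" using w by auto
  ultimately show "y \<in> act x ` (carrier G \<times> Pi\<^sub>E I H)" using \<zeta> by blast
qed

text \<open>Two pairs with the same image differ by an element g of \<open>aut x\<close>:
  multiplying \<zeta>0 by g on the right is undone by the conjugates of \<open>inv g\<close>, which
  lie in the subgroups exactly when g is in \<open>aut x\<close>.\<close>

lemma card_act_fibre:
  assumes x: "x \<in> tuples" and p0: "p0 \<in> carrier G \<times> Pi\<^sub>E I H"
  shows "card {p \<in> carrier G \<times> Pi\<^sub>E I H. act x p = act x p0} = card (aut x)"
proof -
  obtain \<zeta>0 w0 where p0_def: "p0 = (\<zeta>0, w0)" by fastforce
  have \<zeta>0: "\<zeta>0 \<in> carrier G" and w0: "w0 \<in> Pi\<^sub>E I H" using p0 p0_def by auto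
  \<comment> \<open>The second component solves \<zeta>0 \<otimes> g \<otimes> x m \<otimes> w m =
    \<zeta>0 \<otimes> x m \<otimes> w0 m for w m.\<close>
  define f where "f g = (\<zeta>0 \<otimes> g, \<lambda>m\<in>I. inv (x m) \<otimes> inv g \<otimes> x m \<otimes> w0 m)" for g
  have "bij_betw f (aut x) {p \<in> carrier G \<times> Pi\<^sub>E I H. act x p = act x p0}"
  proof (rule bij_betw_imageI)
    show "inj_on f (aut x)"
      using \<zeta>0 by (auto simp: inj_on_def f_def aut_def)
    show "f ` aut x = {p \<in> carrier G \<times> Pi\<^sub>E I H. act x p = act x p0}"
    proof (intro equalityI subsetI)
      fix p assume "p \<in> f ` aut x"
      then obtain g where g: "g \<in> aut x" "p = f g" by blast
      have gG: "g \<in> carrier G" using g by (simp add: aut_def)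
      have "inv g \<in> aut x" using g subgroup_aut[OF x] by (simp add: subgroup.m_inv_closed)
      then have "inv (x m) \<otimes> inv g \<otimes> x m \<otimes> w0 m \<in> H m" if m: "m \<in> I" for m
        using m w0 subgroup.m_closed[OF subgroups[OF m]] by (auto simp: aut_def PiE_iff)
      moreover have "act x (f g) = act x p0"
        unfolding act_def
      proof (rule restrict_ext)
        fix m assume m: "m \<in> I"
        have "x m \<in> carrier G" "w0 m \<in> carrier G"
          using tuples_carrier[OF x m] H_carrier[OF m] w0 m by auto
        then show "fst (f g) \<otimes> x m \<otimes> snd (f g) m = fst p0 \<otimes> x m \<otimes> snd p0 m"
          using m gG \<zeta>0 by (simp add: f_def p0_def m_assoc r_mult_cancel_inv)
      qed
      ultimately show "p \<in> {p \<in> carrier G \<times> Pi\<^sub>E I H. act x p = act x p0}"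
        using g gG \<zeta>0 by (auto simp: f_def)
    next
      fix p assume p: "p \<in> {p \<in> carrier G \<times> Pi\<^sub>E I H. act x p = act x p0}"
      obtain \<zeta> w where p_def: "p = (\<zeta>, w)" by fastforce
      have \<zeta>: "\<zeta> \<in> carrier G" and w: "w \<in> Pi\<^sub>E I H" using p p_def by auto
      define g where "g = inv \<zeta>0 \<otimes> \<zeta>"
      have gG: "g \<in> carrier G" using \<zeta> \<zeta>0 by (simp add: g_def)
      have key: "inv (x m) \<otimes> g \<otimes> x m = w0 m \<otimes> inv (w m) \<and> w m = inv (x m) \<otimes> inv g \<otimes> x m \<otimes> w0 m"
        if m: "m \<in> I" for m
      proof -
        have xm: "x m \<in> carrier G" "w0 m \<in> carrier G" "w m \<in> carrier G"
          using tuples_carrier[OF x m] H_carrier[OF m] w w0 m by auto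
        have "act x p m = act x p0 m" using p by simp
        then have eq: "\<zeta> \<otimes> x m \<otimes> w m = \<zeta>0 \<otimes> x m \<otimes> w0 m" using m by (simp add: act_def p_def p0_def)
        have "inv (x m) \<otimes> g \<otimes> x m = inv (x m) \<otimes> (inv \<zeta>0 \<otimes> (\<zeta> \<otimes> x m \<otimes> w m)) \<otimes> inv (w m)"
          using xm \<zeta> \<zeta>0 by (simp add: g_def m_assoc)
        also have "\<dots> = w0 m \<otimes> inv (w m)"
          unfolding eq using xm \<zeta>0 by (simp add: m_assoc l_mult_cancel_inv)
        finally have 1: "inv (x m) \<otimes> g \<otimes> x m = w0 m \<otimes> inv (w m)" .
        have "inv (x m) \<otimes> inv g \<otimes> x m \<otimes> w0 m = inv (x m) \<otimes> (inv \<zeta> \<otimes> (\<zeta>0 \<otimes> x m \<otimes> w0 m))"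
          using xm \<zeta> \<zeta>0 by (simp add: g_def m_assoc inv_mult_group)
        also have "\<dots> = w m"
          unfolding eq[symmetric] using xm \<zeta> by (simp add: m_assoc l_mult_cancel_inv)
        finally show ?thesis using 1 by simp
      qed
      have "w0 m \<otimes> inv (w m) \<in> H m" if m: "m \<in> I" for m
        using w w0 m subgroups by (auto intro!: subgroup.m_closed subgroup.m_inv_closed simp: PiE_iff)
      then have "g \<in> aut x" using gG key by (simp add: aut_def)
      moreover have "p = f g"
      proof -
        have "\<zeta>0 \<otimes> g = \<zeta>" using \<zeta> \<zeta>0 by (simp add: g_def r_mult_cancel_inv)
        moreover have "w = (\<lambda>m\<in>I. inv (x m) \<otimes> inv g \<otimes> x m \<otimes> w0 m)"
        proof (rule extensionalityI[of w I])
          show "w \<in> extensional I" using w by (simp add: PiE_iff)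
          fix m assume "m \<in> I"
          then show "w m = (\<lambda>m\<in>I. inv (x m) \<otimes> inv g \<otimes> x m \<otimes> w0 m) m" using key[of m] by simp
        qed simp
        ultimately show ?thesis by (simp add: f_def p_def)
      qed
      ultimately show "p \<in> f ` aut x" by blast
    qed
  qed
  from bij_betw_same_card[OF this] show ?thesis by simp
qed

text \<open>Orbit-stabilizer: \<open>act x\<close> maps onto the class of x, and all its fibres have
  the size of \<open>aut x\<close>.\<close>

lemma card_class_times_card_aut:
  assumes x: "x \<in> tuples"
  shows "card (rel `` {x}) * card (aut x) = card (carrier G) * (\<Prod>m\<in>I. card (H m))"
proof -
  let ?M = "carrier G \<times> Pi\<^sub>E I H"
  have fin_H: "finite (H m)" if "m \<in> I" for m
    using fin_carrier H_carrier[OF that] by (meson finite_subset subsetI)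
  have "finite (Pi\<^sub>E I H)" using fin_I fin_H by (rule finite_PiE)
  then have fin: "finite ?M" using fin_carrier by simp
  have "card ?M = (\<Sum>p\<in>?M. 1)" by simp
  also have "\<dots> = (\<Sum>y\<in>act x ` ?M. \<Sum>p\<in>{p \<in> ?M. act x p = y}. 1)"
    using fin by (intro sum.group[symmetric]) auto
  also have "\<dots> = (\<Sum>y\<in>act x ` ?M. card (aut x))"
    using card_act_fibre[OF x] by (intro sum.cong) auto
  finally show ?thesis
    using act_image[OF x] by (simp add: card_cartesian_product card_PiE fin_I)
qed

text \<open>Both orders times the size of the common class give the same number, so no conjugation
  between the two groups has to be exhibited.\<close>

lemma card_aut_rel:
  assumes "(x, y) \<in> rel"
  shows "card (aut x) = card (aut y)"
proof -
  have xy: "x \<in> tuples" "y \<in> tuples" using assms by (auto simp: rel_def)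
  have eq: "rel `` {x} = rel `` {y}" using equiv_class_eq[OF equiv_rel assms] .
  have "finite (rel `` {x})"
    by (rule finite_subset[OF _ finite_tuples]) (auto simp: rel_def)
  moreover have "y \<in> rel `` {x}" using assms by simp
  ultimately have "card (rel `` {x}) \<noteq> 0" by auto
  moreover have "card (rel `` {x}) * card (aut x) = card (rel `` {x}) * card (aut y)"
    using card_class_times_card_aut[OF xy(1)] card_class_times_card_aut[OF xy(2)] by (simp only: eq)
  ultimately show ?thesis by simp
qed

text \<open>P selects whole classes, and within a class the orders of \<open>aut x\<close> add up to
  the same constant for every class. Weighting tuples by these orders therefore counts
  classes.\<close>

lemma sum_card_aut:
  assumes inv: "\<And>x y. (x, y) \<in> rel \<Longrightarrow> P x \<longleftrightarrow> P y"
  shows "(\<Sum>x | x \<in> tuples \<and> P x. card (aut x)) =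
    card {C \<in> tuples // rel. \<exists>x\<in>C. P x} * (card (carrier G) * (\<Prod>m\<in>I. card (H m)))"
proof -
  let ?Q = "{C \<in> tuples // rel. \<exists>x\<in>C. P x}"
  let ?N = "card (carrier G) * (\<Prod>m\<in>I. card (H m))"
  have class_eq: "C = rel `` {x}" if "C \<in> tuples // rel" "x \<in> C" for C x
    using that equiv_rel by (metis Image_singleton_iff equiv_class_eq quotientE)
  have sub: "C \<subseteq> tuples" if "C \<in> tuples // rel" for C
    using that equiv_rel Union_quotient by blast
  have all: "P x" if "C \<in> ?Q" "x \<in> C" for C x
  proof -
    obtain y where y: "C \<in> tuples // rel" "y \<in> C" "P y" using \<open>C \<in> ?Q\<close> by blast
    then have "(y, x) \<in> rel" using class_eq[of C y] that(2) by simp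
    then show ?thesis using inv y(3) by blast
  qed
  have "{x. x \<in> tuples \<and> P x} = \<Union> ?Q"
  proof safe
    fix x assume x: "x \<in> tuples" "P x"
    then have "x \<in> rel `` {x}" using equiv_rel equiv_class_self by metis
    moreover have "rel `` {x} \<in> tuples // rel" using x(1) by (rule quotientI)
    ultimately show "x \<in> \<Union> ?Q" using x by blast
  qed (use sub all in blast)+
  then have "(\<Sum>x | x \<in> tuples \<and> P x. card (aut x)) = (\<Sum>C\<in>?Q. \<Sum>x\<in>C. card (aut x))"
    using sum.Union_disjoint[of ?Q "\<lambda>x. card (aut x)"] quotient_disj[OF equiv_rel]
      finite_subset[OF sub finite_tuples] by (simp add: comp_def) blast
  also have "\<dots> = (\<Sum>C\<in>?Q. ?N)"
  proof (rule sum.cong)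
    fix C assume C: "C \<in> ?Q"
    then obtain x0 where x0: "x0 \<in> C" by blast
    have fin: "finite C" using C sub finite_subset[OF _ finite_tuples] by blast
    have eq: "card C * card (aut x) = ?N" if "x \<in> C" for x
    proof -
      have "x \<in> tuples" using C sub that by blast
      moreover have "C = rel `` {x}" using C class_eq that by blast
      ultimately show ?thesis using card_class_times_card_aut by simp
    qed
    have "card C > 0" using x0 fin by (auto simp: card_gt_0_iff)
    then have "card (aut x) = card (aut x0)" if "x \<in> C" for x
      using eq[OF that] eq[OF x0] by (metis mult_left_cancel neq0_conv)
    then have "(\<Sum>x\<in>C. card (aut x)) = card C * card (aut x0)" by simp
    then show "(\<Sum>x\<in>C. card (aut x)) = ?N" using eq[OF x0] by simp
  qed simp
  finally show ?thesis by simp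
qed

end

section \<open>Subgroups of cyclic groups\<close>

context group
begin

text \<open>In the quotient by N every element raised to the order of the quotient is
  trivial.\<close>

lemma pow_card_rcosets_in_normal:
  assumes "N \<lhd> G" "x \<in> carrier G"
  shows "x [^] card (rcosets N) \<in> N"
proof -
  interpret N: normal N G by (rule assms(1))
  have "Coset.order (G Mod N) = card (rcosets N)" by (simp add: Coset.order_def FactGroup_def)
  moreover have "N #> x \<in> carrier (G Mod N)" using assms(2) by (auto simp: carrier_FactGroup)
  ultimately have "(N #> x) [^]\<^bsub>G Mod N\<^esub> card (rcosets N) = N"
    using group.pow_order_eq_1[OF N.factorgroup_is_group, of "N #> x"] by simp
  then have "N #> (x [^] card (rcosets N)) = N" using N.FactGroup_pow[OF assms(2)] by simp
  then show ?thesis using rcos_self[OF _ N.subgroup_axioms, of "x [^] card (rcosets N)"] assms(2) by simp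
qed

lemma card_subgroup_dvd_card_subgroup:
  assumes "subgroup H G" "subgroup K G" "H \<subseteq> K"
  shows "card H dvd card K"
proof -
  interpret K: group "G\<lparr>carrier := K\<rparr>" using assms(2) by (rule subgroup_imp_group)
  have "card H dvd Coset.order (G\<lparr>carrier := K\<rparr>)"
    using K.lagrange[OF subgroup_incl[OF assms]] by (metis dvd_triv_right)
  then show ?thesis by (simp add: Coset.order_def)
qed

text \<open>Let g generate G and let n be the index of K, so that g^n lies in K. If |H| divides |K|,
  an element g^i of H satisfies g^(i|K|) = 1; then |G| = n|K| divides i|K|, so n divides i and g^i
  is a power of g^n.\<close>

lemma cyclic_subgroup_subset_iff:
  assumes cyclic: "cyclic_group G" and fin: "finite (carrier G)"
    and H: "subgroup H G" and K: "subgroup K G"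
  shows "H \<subseteq> K \<longleftrightarrow> card H dvd card K"
proof
  assume "H \<subseteq> K"
  then show "card H dvd card K" by (rule card_subgroup_dvd_card_subgroup[OF H K])
next
  assume dvd: "card H dvd card K"
  interpret comm_group G using cyclic by (rule cyclic_imp_abelian_group)
  obtain g where g: "g \<in> carrier G" "carrier G = range (\<lambda>n::int. g [^] n)"
    using cyclic unfolding cyclic_group by blast
  define n where "n = card (rcosets K)"
  have nK: "n * card K = Coset.order G" unfolding n_def by (rule lagrange[OF K])
  have ord: "ord g = Coset.order G"
  proof -
    have "generate G {g} = carrier G" using g by (auto simp: generate_pow)
    then show ?thesis using generate_pow_card[OF g(1)] by (simp add: Coset.order_def)
  qed
  have "g [^] n \<in> K" using pow_card_rcosets_in_normal[OF subgroup_imp_normal[OF K] g(1)] by (simp add: n_def)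
  show "H \<subseteq> K"
  proof
    fix h assume h: "h \<in> H"
    then have hG: "h \<in> carrier G" using subgroup.mem_carrier[OF H] by blast
    then obtain i :: int where i: "h = g [^] i" using g(2) by blast
    interpret H: group "G\<lparr>carrier := H\<rparr>" using H by (rule subgroup_imp_group)
    have "h [^] card H = \<one>"
      using H.pow_order_eq_1[of h] h nat_pow_consistent by (simp add: Coset.order_def)
    then have "h [^] card K = \<one>"
      using dvd hG by (metis dvdE nat_pow_one nat_pow_pow)
    then have "g [^] (i * int (card K)) = \<one>"
      using g(1) i by (metis int_pow_int int_pow_pow)
    then have "int (ord g) dvd i * int (card K)" using int_pow_eq_id[OF g(1)] by blast
    then have "int n * int (card K) dvd i * int (card K)" by (simp add: ord flip: nK)
    moreover have "card K \<noteq> 0"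
      using subgroup.one_closed[OF K] finite_subset[OF subgroup.subset[OF K] fin] by auto
    ultimately have "int n dvd i" by simp
    then obtain j where "i = int n * j" by (elim dvdE)
    then have "h = (g [^] n) [^] j" using g(1) i by (metis int_pow_int int_pow_pow)
    then show "h \<in> K" using \<open>g [^] n \<in> K\<close> K by (simp add: subgroup_int_pow_closed)
  qed
qed

text \<open>With n the index of H, the power g^n of a generator lies in H and has order |H|, hence
  generates H.\<close>

lemma cyclic_subgroup:
  assumes cyclic: "cyclic_group G" and fin: "finite (carrier G)" and H: "subgroup H G"
  shows "cyclic_group (G\<lparr>carrier := H\<rparr>)"
proof -
  interpret comm_group G using cyclic by (rule cyclic_imp_abelian_group)
  obtain g where g: "g \<in> carrier G" "carrier G = range (\<lambda>n::int. g [^] n)"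
    using cyclic unfolding cyclic_group by blast
  define n where "n = card (rcosets H)"
  have nH: "n * card H = Coset.order G" unfolding n_def by (rule lagrange[OF H])
  have ord: "ord g = Coset.order G"
  proof -
    have "generate G {g} = carrier G" using g by (auto simp: generate_pow)
    then show ?thesis using generate_pow_card[OF g(1)] by (simp add: Coset.order_def)
  qed
  have y: "g [^] n \<in> H" using pow_card_rcosets_in_normal[OF subgroup_imp_normal[OF H] g(1)] by (simp add: n_def)
  have "Coset.order G > 0" using fin by (simp add: order_gt_0_iff_finite)
  then have "n \<noteq> 0" using nH by (metis mult_0 less_irrefl)
  then have "ord (g [^] n) = card H"
    using ord_pow[OF g(1), of n] ord nH by (metis dvd_triv_left nonzero_mult_div_cancel_left)
  then have card: "card (generate G {g [^] n}) = card H"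
    using generate_pow_card[of "g [^] n"] g(1) by simp
  have "generate G {g [^] n} \<subseteq> H" using y H by (intro generate_subgroup_incl) auto
  then have "generate G {g [^] n} = H"
    using card finite_subset[OF subgroup.subset[OF H] fin] by (intro card_subset_eq) auto
  then have "H = range (\<lambda>i::int. (g [^] n) [^] i)"
    using g(1) by (auto simp: generate_pow)
  also have "\<dots> = range (\<lambda>i::int. (g [^] n) [^]\<^bsub>G\<lparr>carrier := H\<rparr>\<^esub> i)"
    using int_pow_consistent[OF H y] by simp
  finally have "H = range (\<lambda>i::int. (g [^] n) [^]\<^bsub>G\<lparr>carrier := H\<rparr>\<^esub> i)" .
  then show ?thesis
    unfolding group.cyclic_group[OF subgroup_imp_group[OF H]] using y by auto
qed

text \<open>If \<theta> c differs from 1, translating the sum by c multiplies it by \<theta> c while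
  leaving it unchanged, which forces it to vanish.\<close>

lemma sum_multiplicative_over_subgroup:
  fixes \<theta> :: "'a \<Rightarrow> 'k :: idom"
  assumes A: "subgroup A G" and mult: "\<And>g h. g \<in> A \<Longrightarrow> h \<in> A \<Longrightarrow> \<theta> (g \<otimes> h) = \<theta> g * \<theta> h"
  shows "(\<Sum>g\<in>A. \<theta> g) = (if \<forall>g\<in>A. \<theta> g = 1 then of_nat (card A) else 0)"
proof (cases "\<forall>g\<in>A. \<theta> g = 1")
  case False
  then obtain c where c: "c \<in> A" "\<theta> c \<noteq> 1" by blast
  have cG: "c \<in> carrier G" using c(1) subgroup.mem_carrier[OF A] by blast
  have "(\<Sum>g\<in>A. \<theta> g) = (\<Sum>g\<in>A. \<theta> (c \<otimes> g))"
    using c(1) cG subgroup.mem_carrier[OF A] subgroup.m_closed[OF A] subgroup.m_inv_closed[OF A]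
    by (intro sum.reindex_bij_witness[of _ "\<lambda>g. c \<otimes> g" "\<lambda>g. inv c \<otimes> g"]) (auto simp: m_assoc[symmetric])
  also have "\<dots> = \<theta> c * (\<Sum>g\<in>A. \<theta> g)" using c(1) by (simp add: mult sum_distrib_left)
  finally have "(\<Sum>g\<in>A. \<theta> g) = 0" using c(2) by simp
  then show ?thesis by (simp only: False if_False)
qed simp

end

section \<open>The number of superpositions\<close>

lemma (in group) conjugation_hom:
  assumes "c \<in> carrier G"
  shows "(\<lambda>g. inv c \<otimes> g \<otimes> c) \<in> hom G G"
  using assms by (auto simp: hom_def m_assoc r_mult_cancel_inv)

context superposition
begin

text \<open>The conjugate copy of \<open>aut x\<close> inside \<open>H i\<close>, where cyclicity
  and the kernel of a character of \<open>H i\<close> are available.\<close>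

definition transported_aut :: "'i \<Rightarrow> ('i \<Rightarrow> 'a) \<Rightarrow> 'a set" where
  "transported_aut i x = (\<lambda>g. inv (x i) \<otimes> g \<otimes> x i) ` aut x"

lemma
  assumes x: "x \<in> tuples" and i: "i \<in> I"
  shows subgroup_transported_aut: "subgroup (transported_aut i x) (G\<lparr>carrier := H i\<rparr>)"
    and card_transported_aut: "card (transported_aut i x) = card (aut x)"
    and conjugation_transported_aut: "(\<lambda>g. x i \<otimes> g \<otimes> inv (x i)) ` transported_aut i x = aut x"
proof -
  have xi: "x i \<in> carrier G" using x i by (rule tuples_carrier)
  interpret conj: group_hom G G "\<lambda>g. inv (x i) \<otimes> g \<otimes> x i"
    using conjugation_hom[OF xi] by unfold_locales
  have "subgroup (transported_aut i x) G"
    unfolding transported_aut_def using subgroup_aut[OF x] by (rule conj.subgroup_img_is_subgroup)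
  moreover have "transported_aut i x \<subseteq> H i" using i by (auto simp: transported_aut_def aut_def)
  ultimately show "subgroup (transported_aut i x) (G\<lparr>carrier := H i\<rparr>)"
    using subgroups[OF i] by (intro subgroup_incl)
  have "x i \<otimes> (inv (x i) \<otimes> g \<otimes> x i) \<otimes> inv (x i) = g" if "g \<in> carrier G" for g
    using that xi by (simp add: m_assoc r_mult_cancel_inv)
  then have cancel: "x i \<otimes> (inv (x i) \<otimes> g \<otimes> x i) \<otimes> inv (x i) = g" if "g \<in> aut x" for g
    using that by (simp add: aut_def)
  then have "inj_on (\<lambda>g. inv (x i) \<otimes> g \<otimes> x i) (aut x)" by (metis (no_types, lifting) inj_onI)
  then show "card (transported_aut i x) = card (aut x)"
    unfolding transported_aut_def by (rule card_image)
  show "(\<lambda>g. x i \<otimes> g \<otimes> inv (x i)) ` transported_aut i x = aut x"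
    unfolding transported_aut_def image_image using cancel by (simp cong: image_cong)
qed

text \<open>\<open>aut x\<close> is a conjugate of a subgroup of the cyclic group
  \<open>H i\<close>; in the final count only its order remains to be controlled.\<close>

lemma aut_cyclic:
  assumes x: "x \<in> tuples" and i: "i \<in> I" and cyclic: "cyclic_group (G\<lparr>carrier := H i\<rparr>)"
  shows "cyclic_group (G\<lparr>carrier := aut x\<rparr>)"
proof -
  let ?T = "transported_aut i x"
  interpret Hi: group "G\<lparr>carrier := H i\<rparr>" using subgroups[OF i] by (rule subgroup_imp_group)
  have xi: "x i \<in> carrier G" using x i by (rule tuples_carrier)
  have fin: "finite (H i)" using fin_carrier subgroup.subset[OF subgroups[OF i]] finite_subset by blast
  have T: "subgroup ?T (G\<lparr>carrier := H i\<rparr>)" using x i by (rule subgroup_transported_aut)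
  have TG: "?T \<subseteq> carrier G"
    using subgroup.subset[OF T] subgroup.subset[OF subgroups[OF i]] by simp
  have "cyclic_group (G\<lparr>carrier := ?T\<rparr>)"
    using Hi.cyclic_subgroup[OF cyclic _ T] fin by simp
  moreover have "(\<lambda>g. x i \<otimes> g \<otimes> inv (x i)) \<in> epi (G\<lparr>carrier := ?T\<rparr>) (G\<lparr>carrier := aut x\<rparr>)"
  proof -
    have "(\<lambda>g. x i \<otimes> g \<otimes> inv (x i)) \<in> hom G G" using conjugation_hom[of "inv (x i)"] xi by simp
    then show ?thesis
      using conjugation_transported_aut[OF x i] TG by (auto simp: epi_def hom_def subset_iff)
  qed
  moreover have "group (G\<lparr>carrier := ?T\<rparr>)" using Hi.subgroup_imp_group[OF T] by simp
  moreover have "group (G\<lparr>carrier := aut x\<rparr>)" using subgroup_imp_group[OF subgroup_aut[OF x]] .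
  ultimately show ?thesis using group.cyclic_group_epimorphic_image by blast
qed

text \<open>For K the kernel of a character of \<open>H i\<close>, this converts a condition on an
  order into triviality of the character transported to \<open>aut x\<close>.\<close>

lemma card_aut_dvd_iff:
  assumes x: "x \<in> tuples" and i: "i \<in> I" and cyclic: "cyclic_group (G\<lparr>carrier := H i\<rparr>)"
    and K: "subgroup K (G\<lparr>carrier := H i\<rparr>)"
  shows "card (aut x) dvd card K \<longleftrightarrow> (\<forall>g\<in>aut x. inv (x i) \<otimes> g \<otimes> x i \<in> K)"
proof -
  interpret Hi: group "G\<lparr>carrier := H i\<rparr>" using subgroups[OF i] by (rule subgroup_imp_group)
  have "finite (H i)" using fin_carrier subgroup.subset[OF subgroups[OF i]] finite_subset by blast
  then have "transported_aut i x \<subseteq> K \<longleftrightarrow> card (transported_aut i x) dvd card K"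
    using Hi.cyclic_subgroup_subset_iff[OF cyclic _ subgroup_transported_aut[OF x i] K] by simp
  then show ?thesis using card_transported_aut[OF x i] by (auto simp: transported_aut_def)
qed

text \<open>Expanding the product of sums selects one s for every m, that is, a tuple x. The
  resulting product vanishes unless every conjugate of \<sigma> lands in its subgroup, which is
  membership in \<open>aut x\<close>.\<close>

lemma sum_prod_conjugates:
  fixes \<chi> :: "'i \<Rightarrow> 'a \<Rightarrow> 'k :: field"
  shows "(\<Sum>\<sigma>\<in>carrier G. \<Prod>m\<in>I. \<Sum>s\<in>carrier G. extend_zero (H m) (\<chi> m) (inv s \<otimes> \<sigma> \<otimes> s)) =
    (\<Sum>x\<in>tuples. \<Sum>\<sigma>\<in>aut x. \<Prod>m\<in>I. \<chi> m (inv (x m) \<otimes> \<sigma> \<otimes> x m))"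
proof -
  have "(\<Sum>\<sigma>\<in>carrier G. \<Prod>m\<in>I. \<Sum>s\<in>carrier G. extend_zero (H m) (\<chi> m) (inv s \<otimes> \<sigma> \<otimes> s)) =
      (\<Sum>x\<in>tuples. \<Sum>\<sigma>\<in>carrier G. \<Prod>m\<in>I. extend_zero (H m) (\<chi> m) (inv (x m) \<otimes> \<sigma> \<otimes> x m))"
    by (subst sum.swap) (simp add: prod_sum_PiE[OF fin_I fin_carrier] tuples_def)
  also have "\<dots> = (\<Sum>x\<in>tuples. \<Sum>\<sigma>\<in>aut x. \<Prod>m\<in>I. \<chi> m (inv (x m) \<otimes> \<sigma> \<otimes> x m))"
    by (intro sum.cong refl sum.mono_neutral_cong_right fin_carrier ballI)
      (auto simp: aut_def extend_zero_def prod_zero_iff fin_I intro!: prod.cong)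
  finally show ?thesis .
qed

end

section \<open>Graph automorphism groups and superpositions inside S_d\<close>

lemma subgroup_graph_aut: "subgroup (graph_aut d E) (sym_group d)"
proof -
  interpret G: group "sym_group d" by (rule sym_group_is_group)
  have image: "\<sigma> i \<in> {1..d}" if "\<sigma> \<in> carrier (sym_group d)" "i \<in> {1..d}" for \<sigma> i
    using that permutes_in_image[of \<sigma> "{1..d}" i] by (simp add: sym_group_carrier)
  show ?thesis
  proof (rule G.subgroupI)
    show "graph_aut d E \<subseteq> carrier (sym_group d)" by (auto simp: graph_aut_def)
    have "id \<in> graph_aut d E" using G.one_closed by (simp add: graph_aut_def sym_group_one)
    then show "graph_aut d E \<noteq> {}" by blast
  next
    fix \<sigma> assume \<sigma>: "\<sigma> \<in> graph_aut d E"
    then have \<sigma>G: "\<sigma> \<in> carrier (sym_group d)" by (simp add: graph_aut_def)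
    then have inv: "inv' \<sigma> \<in> carrier (sym_group d)" by (rule sym_group_inv_closed)
    have "count E (Upair (inv' \<sigma> i) (inv' \<sigma> j)) = count E (Upair i j)" if "i \<in> {1..d}" "j \<in> {1..d}" for i j
    proof -
      have "count E (Upair (\<sigma> (inv' \<sigma> i)) (\<sigma> (inv' \<sigma> j))) = count E (Upair (inv' \<sigma> i) (inv' \<sigma> j))"
        using \<sigma> image[OF inv that(1)] image[OF inv that(2)] unfolding graph_aut_def by blast
      moreover have "\<sigma> (inv' \<sigma> l) = l" for l
        using \<sigma>G permutes_inverses(1) by (auto simp: sym_group_carrier)
      ultimately show ?thesis by simp
    qed
    then show "inv\<^bsub>sym_group d\<^esub> \<sigma> \<in> graph_aut d E" using inv \<sigma>G by (simp add: graph_aut_def)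
  next
    fix \<sigma> \<tau> assume "\<sigma> \<in> graph_aut d E" "\<tau> \<in> graph_aut d E"
    then show "\<sigma> \<otimes>\<^bsub>sym_group d\<^esub> \<tau> \<in> graph_aut d E"
      using image G.m_closed[of \<sigma> \<tau>] by (auto simp: graph_aut_def sym_group_mult)
  qed
qed

text \<open>For k = 0 the empty intersection would be the set of all functions, whereas
  \<open>aut\<close> stays inside S_d; a single m already forces membership in the carrier.\<close>

lemma superpos_aut_eq_aut:
  assumes S: "superposition (sym_group d) {1..k} W" and k: "k \<ge> 1"
    and x: "x \<in> superposition.tuples (sym_group d) {1..k}"
  shows "superpos_aut d k W x = superposition.aut (sym_group d) {1..k} W x"
proof -
  interpret superposition "sym_group d" "{1..k}" W by (rule S)
  let ?G = "sym_group d"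
  have "g \<in> {x m \<circ> w \<circ> inv\<^bsub>?G\<^esub> (x m) | w. w \<in> W m} \<longleftrightarrow>
      g \<in> carrier ?G \<and> inv\<^bsub>?G\<^esub> (x m) \<otimes>\<^bsub>?G\<^esub> g \<otimes>\<^bsub>?G\<^esub> x m \<in> W m"
    if m: "m \<in> {1..k}" for g m
  proof -
    have xm: "x m \<in> carrier ?G" using x m by (rule tuples_carrier)
    have 1: "inv\<^bsub>?G\<^esub> (x m) \<otimes>\<^bsub>?G\<^esub> (x m \<otimes>\<^bsub>?G\<^esub> w \<otimes>\<^bsub>?G\<^esub> inv\<^bsub>?G\<^esub> (x m)) \<otimes>\<^bsub>?G\<^esub> x m = w"
      if "w \<in> carrier ?G" for w
      using that xm by (simp add: m_assoc l_mult_cancel_inv del: sym_group_inv_equality)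
    have 2: "x m \<otimes>\<^bsub>?G\<^esub> (inv\<^bsub>?G\<^esub> (x m) \<otimes>\<^bsub>?G\<^esub> w \<otimes>\<^bsub>?G\<^esub> x m) \<otimes>\<^bsub>?G\<^esub> inv\<^bsub>?G\<^esub> (x m) = w"
      if "w \<in> carrier ?G" for w
      using that xm by (simp add: m_assoc r_mult_cancel_inv del: sym_group_inv_equality)
    have 3: "x m \<otimes>\<^bsub>?G\<^esub> w \<otimes>\<^bsub>?G\<^esub> inv\<^bsub>?G\<^esub> (x m) \<in> carrier ?G" if "w \<in> carrier ?G" for w
      using that xm by (intro m_closed inv_closed)
    show ?thesis
      unfolding sym_group_mult[of d, symmetric] mem_Collect_eq
      using 1 2 3 H_carrier[OF m] by metis
  qed
  then show ?thesis
    using k unfolding superpos_aut_def aut_def by fastforce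
qed


theorem corollary3p1p2:
  fixes d k a b :: nat
    and \<Gamma> :: "nat \<Rightarrow> nat uprod multiset"
    and W :: "nat \<Rightarrow> (nat \<Rightarrow> nat) set"
    and \<rho> :: "(nat \<Rightarrow> nat) \<Rightarrow> 'k :: {alg_closed_field, field_char_0}"
  assumes "d \<ge> 1" and "k \<ge> 1"
    and graphs: "\<And>m. m \<in> {1..k} \<Longrightarrow> multigraph d (\<Gamma> m)"
    and auts: "\<And>m. m \<in> {1..k} \<Longrightarrow> W m = graph_aut d (\<Gamma> m)"
    and cyclic: "cyclic_group (sub_sym d (W 1))" "card (W 1) = b"
    and divisor: "a dvd b"
    and character: "\<rho> \<in> hom (sub_sym d (W 1)) mult_field"
    and kernel_order: "card (kernel (sub_sym d (W 1)) mult_field \<rho>) = a"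
  shows "of_nat (card {C \<in> superpositions d k W. \<exists>x\<in>C.
            cyclic_group (sub_sym d (superpos_aut d k W x)) \<and> card (superpos_aut d k W x) dvd a})
       = coeff_sum d (foldl (internal_prod d) (cycle_index d (W 1) \<rho>)
            (map (\<lambda>m. cycle_index d (W m) (\<lambda>_. 1)) [2..<Suc k]))"
proof -
  let ?G = "sym_group d"
  let ?K = "kernel (sub_sym d (W 1)) mult_field \<rho>"
  have subgroup_W: "subgroup (W m) ?G" if "m \<in> {1..k}" for m
    using auts[OF that] subgroup_graph_aut by simp
  interpret S: superposition ?G "{1..k}" W
    using sym_group_is_group finite_carrier_sym_group subgroup_W
    by (intro superposition.intro superposition_axioms.intro) auto
  have one_in: "1 \<in> {1..k}" using \<open>k \<ge> 1\<close> by simp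
  have finite_W: "finite (W m)" "card (W m) \<noteq> 0" if "m \<in> {1..k}" for m
  proof -
    show "finite (W m)"
      using finite_subset[OF subgroup.subset[OF subgroup_W[OF that]] finite_carrier_sym_group] .
    moreover have "W m \<noteq> {}" using subgroup.one_closed[OF subgroup_W[OF that]] by blast
    ultimately show "card (W m) \<noteq> 0" by simp
  qed

  \<comment> \<open>Two constants bear the name \<open>mult_of\<close>; unfolding the definitions
    turns the product of \<open>mult_field\<close> into the product of the type.\<close>
  have \<rho>_hom: "\<rho> (\<sigma> \<otimes>\<^bsub>?G\<^esub> \<tau>) = \<rho> \<sigma> * \<rho> \<tau>" if "\<sigma> \<in> W 1" "\<tau> \<in> W 1" for \<sigma> \<tau>
    using character that
    by (simp add: hom_def Multiplicative_Group.mult_of_def Ring_Divisibility.mult_of_def ring_of_type_algebra_def)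
  interpret W1: group "sub_sym d (W 1)"
    using S.subgroup_imp_group[OF subgroup_W[OF one_in]] .
  have group_K: "group (mult_field :: 'k monoid)"
    using field.field_mult_group[OF field_from_type_algebra]
    by (simp add: Multiplicative_Group.mult_of_def Ring_Divisibility.mult_of_def)
  interpret \<rho>: group_hom "sub_sym d (W 1)" mult_field \<rho>
    using character group_K by (intro group_hom.intro group_hom_axioms.intro W1.group_axioms)
  have kernel: "\<sigma> \<in> ?K \<longleftrightarrow> \<sigma> \<in> W 1 \<and> \<rho> \<sigma> = 1" for \<sigma>
    by (simp add: kernel_def Multiplicative_Group.mult_of_def Ring_Divisibility.mult_of_def ring_of_type_algebra_def)
  have \<rho>_one: "\<rho> \<one>\<^bsub>?G\<^esub> = 1"
    using kernel[of "\<one>\<^bsub>?G\<^esub>"] subgroup.one_closed[OF \<rho>.subgroup_kernel] by simp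

  \<comment> \<open>One family covers \<rho> and the trivial characters, so the product over all m
    reduces to the single factor \<rho> at m = 1.\<close>
  define \<chi> where "\<chi> m = (if m = 1 then \<rho> else (\<lambda>_. 1))" for m :: nat
  have linear: "linear_character ?G (W m) (\<chi> m)" if "m \<in> {1..k}" for m
    using subgroup_W[OF that] \<rho>_hom \<rho>_one
    by (intro linear_character.intro linear_character_axioms.intro sym_group_is_group) (auto simp: \<chi>_def)
  have prod_\<chi>: "(\<Prod>m\<in>{1..k}. \<chi> m (f m)) = \<rho> (f 1)" for f
    using prod.remove[OF _ one_in, of "\<lambda>m. \<chi> m (f m)"] by (simp add: \<chi>_def)

  let ?P = "\<lambda>x. card (S.aut x) dvd a"
  \<comment> \<open>Here a enters as the order of the kernel: lying in the unique subgroup of order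
    a of W 1 means being killed by \<rho>.\<close>
  have P: "?P x \<longleftrightarrow> (\<forall>g\<in>S.aut x. \<rho> (inv\<^bsub>?G\<^esub> (x 1) \<otimes>\<^bsub>?G\<^esub> g \<otimes>\<^bsub>?G\<^esub> x 1) = 1)" if "x \<in> S.tuples" for x
  proof -
    have "?P x \<longleftrightarrow> (\<forall>g\<in>S.aut x. inv\<^bsub>?G\<^esub> (x 1) \<otimes>\<^bsub>?G\<^esub> g \<otimes>\<^bsub>?G\<^esub> x 1 \<in> ?K)"
      using S.card_aut_dvd_iff[OF that one_in cyclic(1) \<rho>.subgroup_kernel] kernel_order by simp
    moreover have "inv\<^bsub>?G\<^esub> (x 1) \<otimes>\<^bsub>?G\<^esub> g \<otimes>\<^bsub>?G\<^esub> x 1 \<in> W 1" if "g \<in> S.aut x" for g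
      using that one_in unfolding S.aut_def by blast
    ultimately show ?thesis unfolding kernel by blast
  qed

  have rel: "superpos_rel d k W = S.rel" and tuples: "perm_tuples d k = S.tuples"
    by (simp_all only: superpos_rel_def S.rel_def perm_tuples_def S.tuples_def sym_group_mult)
  have good: "cyclic_group (sub_sym d (superpos_aut d k W x)) \<and> card (superpos_aut d k W x) dvd a \<longleftrightarrow> ?P x"
    if "x \<in> S.tuples" for x
    using S.aut_cyclic[OF that one_in cyclic(1)] superpos_aut_eq_aut[OF S.superposition_axioms \<open>k \<ge> 1\<close> that] by simp
  have in_tuples: "x \<in> S.tuples" if "C \<in> S.tuples // S.rel" "x \<in> C" for C x
    using that S.equiv_rel Union_quotient by blast
  have classes: "{C \<in> superpositions d k W. \<exists>x\<in>C.
      cyclic_group (sub_sym d (superpos_aut d k W x)) \<and> card (superpos_aut d k W x) dvd a} =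
      {C \<in> S.tuples // S.rel. \<exists>x\<in>C. ?P x}" (is "_ = ?Q")
    unfolding superpositions_def rel tuples using good in_tuples by blast
  \<comment> \<open>The constant of the orbit count, taken in the field; characteristic zero makes
    it nonzero, so it can be cancelled at the end.\<close>
  let ?N = "of_nat (card (carrier ?G)) * (\<Prod>m\<in>{1..k}. of_nat (card (W m))) :: 'k"
  have "card (carrier ?G) \<noteq> 0" using S.one_closed finite_carrier_sym_group by auto
  then have N: "?N \<noteq> 0" using finite_W(2) by simp

  have aut_sum: "(\<Sum>\<sigma>\<in>S.aut x. \<Prod>m\<in>{1..k}. \<chi> m (inv\<^bsub>?G\<^esub> (x m) \<otimes>\<^bsub>?G\<^esub> \<sigma> \<otimes>\<^bsub>?G\<^esub> x m)) =
      (if ?P x then of_nat (card (S.aut x)) else 0)" if x: "x \<in> S.tuples" for x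
  proof -
    have x1: "x 1 \<in> carrier ?G" using x one_in by (rule S.tuples_carrier)
    have "\<rho> (inv\<^bsub>?G\<^esub> (x 1) \<otimes>\<^bsub>?G\<^esub> (g \<otimes>\<^bsub>?G\<^esub> h) \<otimes>\<^bsub>?G\<^esub> x 1) =
        \<rho> (inv\<^bsub>?G\<^esub> (x 1) \<otimes>\<^bsub>?G\<^esub> g \<otimes>\<^bsub>?G\<^esub> x 1) * \<rho> (inv\<^bsub>?G\<^esub> (x 1) \<otimes>\<^bsub>?G\<^esub> h \<otimes>\<^bsub>?G\<^esub> x 1)"
      if g: "g \<in> S.aut x" and h: "h \<in> S.aut x" for g h
    proof -
      have "g \<in> carrier ?G" "h \<in> carrier ?G" using g h unfolding S.aut_def by blast+
      then have "inv\<^bsub>?G\<^esub> (x 1) \<otimes>\<^bsub>?G\<^esub> (g \<otimes>\<^bsub>?G\<^esub> h) \<otimes>\<^bsub>?G\<^esub> x 1 =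
          (inv\<^bsub>?G\<^esub> (x 1) \<otimes>\<^bsub>?G\<^esub> g \<otimes>\<^bsub>?G\<^esub> x 1) \<otimes>\<^bsub>?G\<^esub> (inv\<^bsub>?G\<^esub> (x 1) \<otimes>\<^bsub>?G\<^esub> h \<otimes>\<^bsub>?G\<^esub> x 1)"
        using hom_mult[OF S.conjugation_hom[OF x1]] by blast
      moreover have "inv\<^bsub>?G\<^esub> (x 1) \<otimes>\<^bsub>?G\<^esub> g \<otimes>\<^bsub>?G\<^esub> x 1 \<in> W 1" "inv\<^bsub>?G\<^esub> (x 1) \<otimes>\<^bsub>?G\<^esub> h \<otimes>\<^bsub>?G\<^esub> x 1 \<in> W 1"
        using g h one_in unfolding S.aut_def by blast+
      ultimately show ?thesis using \<rho>_hom by metis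
    qed
    from S.sum_multiplicative_over_subgroup[OF S.subgroup_aut[OF x] this]
    show ?thesis unfolding prod_\<chi> P[OF x] .
  qed

  have "coeff_sum d (foldl (internal_prod d) (cycle_index d (W 1) \<rho>)
      (map (\<lambda>m. cycle_index d (W m) (\<lambda>_. 1)) [2..<Suc k])) =
      coeff_sum d (ch d (\<lambda>\<sigma>\<in>carrier ?G. \<Prod>m\<in>{1..k}. induced_char d (W m) (\<chi> m) \<sigma>))"
  proof -
    let ?ind = "\<lambda>m. induced_char d (W m) (\<chi> m)"
    have ch_ind: "ch d (?ind m) = cycle_index d (W m) (\<chi> m)" if "m \<in> {1..k}" for m
      by (rule ch_induced_char[OF subgroup_W[OF that]])
    have first: "cycle_index d (W 1) \<rho> = ch d (?ind 1)"
      using ch_ind[OF one_in] by (simp add: \<chi>_def)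
    have rest: "cycle_index d (W m) (\<lambda>_. 1) = ch d (?ind m)" if "m \<in> set [2..<Suc k]" for m
    proof -
      have "m \<in> {1..k}" "m \<noteq> 1" using that by auto
      then show ?thesis using ch_ind[of m] by (simp add: \<chi>_def)
    qed
    have "foldl (internal_prod d) (cycle_index d (W 1) \<rho>) (map (\<lambda>m. cycle_index d (W m) (\<lambda>_. 1)) [2..<Suc k]) =
        foldl (internal_prod d) (ch d (?ind 1)) (map (\<lambda>m. ch d (?ind m)) [2..<Suc k])"
      using first rest by (intro arg_cong2[of _ _ _ _ "foldl (internal_prod d)"] map_cong) auto
    also have "\<dots> = ch d (\<lambda>\<sigma>\<in>carrier ?G. ?ind 1 \<sigma> * (\<Prod>m\<leftarrow>[2..<Suc k]. ?ind m \<sigma>))"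
      using linear one_in by (intro foldl_internal_prod_ch induced_char_in_sym_characters) auto
    \<comment> \<open>The fold starts from the factor of W 1, so its list begins at 2; for k = 1 the
      list is empty and the formula still holds.\<close>
    also have "(\<lambda>\<sigma>\<in>carrier ?G. ?ind 1 \<sigma> * (\<Prod>m\<leftarrow>[2..<Suc k]. ?ind m \<sigma>)) =
        (\<lambda>\<sigma>\<in>carrier ?G. \<Prod>m\<in>{1..k}. ?ind m \<sigma>)"
    proof (rule restrict_ext)
      fix \<sigma>
      have "(\<Prod>m\<leftarrow>[2..<Suc k]. ?ind m \<sigma>) = (\<Prod>m\<in>{2..k}. ?ind m \<sigma>)"
        by (subst prod.distinct_set_conv_list[symmetric])
          (simp_all add: atLeastLessThanSuc_atLeastAtMost del: upt_Suc)
      moreover have "{1..k} - {1} = {2..k}" by auto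
      ultimately show "?ind 1 \<sigma> * (\<Prod>m\<leftarrow>[2..<Suc k]. ?ind m \<sigma>) = (\<Prod>m\<in>{1..k}. ?ind m \<sigma>)"
        using prod.remove[OF _ one_in, of "\<lambda>m. ?ind m \<sigma>"] by simp
    qed
    finally show ?thesis by (rule arg_cong)
  qed
  also have "\<dots> = (\<Sum>\<sigma>\<in>carrier ?G. \<Prod>m\<in>{1..k}. induced_char d (W m) (\<chi> m) \<sigma>) / of_nat (card (carrier ?G))"
  proof -
    \<comment> \<open>The denominator d! is written as a group order so that it later cancels
      against \<open>?N\<close>.\<close>
    have "card (carrier ?G) = fact d" using card_permutations[of "{1..d}" d] by (simp add: sym_group_def)
    then show ?thesis by (simp add: coeff_sum_ch)
  qed
  also have "(\<Sum>\<sigma>\<in>carrier ?G. \<Prod>m\<in>{1..k}. induced_char d (W m) (\<chi> m) \<sigma>) =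
      (\<Sum>\<sigma>\<in>carrier ?G. (\<Prod>m\<in>{1..k}. 1 / of_nat (card (W m))) * (\<Prod>m\<in>{1..k}.
        \<Sum>s\<in>carrier ?G. extend_zero (W m) (\<chi> m) (inv\<^bsub>?G\<^esub> s \<otimes>\<^bsub>?G\<^esub> \<sigma> \<otimes>\<^bsub>?G\<^esub> s)))"
    unfolding sym_group_mult
    by (intro sum.cong refl) (simp only: induced_char_def restrict_apply' prod.distrib)
  also have "\<dots> = (\<Prod>m\<in>{1..k}. 1 / of_nat (card (W m))) *
      (\<Sum>x\<in>S.tuples. \<Sum>\<sigma>\<in>S.aut x. \<Prod>m\<in>{1..k}. \<chi> m (inv\<^bsub>?G\<^esub> (x m) \<otimes>\<^bsub>?G\<^esub> \<sigma> \<otimes>\<^bsub>?G\<^esub> x m))"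
    unfolding sum_distrib_left[symmetric] S.sum_prod_conjugates ..
  \<comment> \<open>From here on the field-valued sum is the image of a natural number, so
    \<open>S.sum_card_aut\<close> applies.\<close>
  also have "(\<Sum>x\<in>S.tuples. \<Sum>\<sigma>\<in>S.aut x. \<Prod>m\<in>{1..k}. \<chi> m (inv\<^bsub>?G\<^esub> (x m) \<otimes>\<^bsub>?G\<^esub> \<sigma> \<otimes>\<^bsub>?G\<^esub> x m)) =
      of_nat (\<Sum>x | x \<in> S.tuples \<and> ?P x. card (S.aut x))"
    unfolding of_nat_sum sum.inter_filter[OF S.finite_tuples] if_distrib[of of_nat] of_nat_0 using aut_sum by (rule sum.cong[OF refl])
  also have "\<dots> = of_nat (card ?Q) * ?N"
  proof -
    have "?P x \<longleftrightarrow> ?P y" if "(x, y) \<in> S.rel" for x y using S.card_aut_rel[OF that] by simp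
    from S.sum_card_aut[of ?P, OF this] show ?thesis by simp
  qed
  also have "(\<Prod>m\<in>{1..k}. 1 / of_nat (card (W m))) * (of_nat (card ?Q) * ?N) / of_nat (card (carrier ?G)) = of_nat (card ?Q)"
    using N by (simp add: prod_dividef field_simps)
  finally show ?thesis unfolding classes by simp
qed

end
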